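(* Fix a dimension $d \ge 1$. For each $\epsilon > 0$ there is a $\delta = \delta(\epsilon) > 0$ such that for every even integer $L \ge 2$, with $\Lambda = (\mathbb{Z}/L\mathbb{Z})^d$ and $2N = L^d$, and for every weighting function $f$ on $\Lambda \times \Lambda$ satisfying $\mathrm{sm}(f) < \delta$, one has $$\left| p(f) - p_0 \right| < \epsilon ,$$ where $p_0 = \frac{1}{2N}\left[ \ln N! - N \ln N \right]$. In particular, $\delta$ may be chosen independently of $N$ (equivalently, of $L$).
   Context: Let $d \ge 1$, let $L$ be an even positive integer, and let $\Lambda = (\mathbb{Z}/L\mathbb{Z})^d$, identified with $\{0,\dots,L-1\}^d \subset \mathbb{Z}^d$. Put $2N = L^d = |\Lambda|$. A vertex of $\Lambda$ is black if the sum of its coordinates is even and white if it is odd. Write $y \perp x$ if $x$ and $y$ have opposite colors. A weighting function is a symmetric function $f : \Lambda \times \Lambda \to \mathbb{R}$, extended to $\mathbb{Z}^d \times \mathbb{Z}^d$ by $L$-periodicity in every coordinate of each variable separately, such that: (i) $f(x,y) > 0$ for all $x,y$; (ii) $f(x+a,y+a) = f(x,y)$ for all $a \in \mathbb{Z}^d$; (iii) $\sum_{y \in \Lambda,\ y \perp x} f(x,y) = 1$ for each $x$. The smoothness $\mathrm{sm}(f)$ is the smallest real number such that $|f(x,y) - f(x,y+u)| \le \mathrm{sm}(f)\, f(x,y)$ for all $x,y$ and all of the $2d$ unit vectors $u$ (plus or minus the standard basis vectors). A tiling of $\Lambda$ is a set of $N$ pairwise disjoint two-element subsets $\{x_j,y_j\}$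 of $\Lambda$ (which therefore cover $\Lambda$), each containing one black and one white vertex. The partition function is $Z(f) = \sum_{T} \prod_{\{x,y\} \in T} f(x,y)$, the sum being over all tilings $T$ of $\Lambda$. The pressure $p(f)$ is defined by $e^{2N p(f)} = Z(f)$. The number $p_0$ is the pressure of the constant weighting function $f_0 = 1/N$. *)

theory Defs
  imports Complex_Main "HOL-Analysis.Finite_Cartesian_Product" "HOL-Library.Disjoint_Sets"
begin

text \<open>The dimension is the cardinality of the index type \<open>'d\<close>. The torus is represented by its
  fundamental domain in the lattice, and functions on the torus by \<open>L\<close>-periodic functions on the
  lattice.\<close>

definition torus :: "nat \<Rightarrow> (int ^ 'd) set" where
  "torus L = {x. \<forall>i. 0 \<le> x $ i \<and> x $ i < int L}"

definition black :: "int ^ 'd \<Rightarrow> bool" where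
  "black x \<longleftrightarrow> even (\<Sum>i\<in>UNIV. x $ i)"

definition opposite :: "int ^ 'd \<Rightarrow> int ^ 'd \<Rightarrow> bool" where
  "opposite x y \<longleftrightarrow> black x \<noteq> black y"

definition weighting :: "nat \<Rightarrow> (int ^ 'd \<Rightarrow> int ^ 'd \<Rightarrow> real) \<Rightarrow> bool" where
  "weighting L f \<longleftrightarrow>
     (\<forall>x y. f x y = f y x) \<and>
     (\<forall>x y i. f (x + axis i (int L)) y = f x y \<and> f x (y + axis i (int L)) = f x y) \<and>
     (\<forall>x y. f x y > 0) \<and>
     (\<forall>x y a. f (x + a) (y + a) = f x y) \<and>
     (\<forall>x. (\<Sum>y\<in>{y \<in> torus L. opposite x y}. f x y) = 1)"

definition unit_vectors :: "(int ^ 'd) set" where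
  "unit_vectors = (\<Union>i. {axis i 1, - axis i 1})"

definition smoothness :: "(int ^ 'd \<Rightarrow> int ^ 'd \<Rightarrow> real) \<Rightarrow> real" where
  "smoothness f =
     (LEAST c. \<forall>x y. \<forall>u\<in>unit_vectors. \<bar>f x y - f x (y + u)\<bar> \<le> c * f x y)"

definition tilings :: "nat \<Rightarrow> (int ^ 'd) set set set" where
  "tilings L = {T. 2 * card T = L ^ CARD('d) \<and> disjoint T \<and>
     (\<forall>e\<in>T. \<exists>x\<in>torus L. \<exists>y\<in>torus L. black x \<and> \<not> black y \<and> e = {x, y})}"

text \<open>The value \<open>f x y\<close> at an unordered pair \<open>{x, y}\<close> is read off with the black vertex first;
  the order does not matter for symmetric \<open>f\<close>.\<close>

definition edge_weight :: "(int ^ 'd \<Rightarrow> int ^ 'd \<Rightarrow> real) \<Rightarrow> (int ^ 'd) set \<Rightarrow> real" where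
  "edge_weight f e = f (THE x. x \<in> e \<and> black x) (THE y. y \<in> e \<and> \<not> black y)"

lemma edge_weight_pair:
  assumes "black x" "\<not> black y"
  shows "edge_weight f {x, y} = f x y"
proof -
  have "(THE z. z \<in> {x, y} \<and> black z) = x" "(THE z. z \<in> {x, y} \<and> \<not> black z) = y"
    using assms by (auto intro!: the_equality)
  then show ?thesis by (simp add: edge_weight_def)
qed

definition partition_function :: "nat \<Rightarrow> (int ^ 'd \<Rightarrow> int ^ 'd \<Rightarrow> real) \<Rightarrow> real" where
  "partition_function L f = (\<Sum>T\<in>tilings L. \<Prod>e\<in>T. edge_weight f e)"

text \<open>The solution \<open>p\<close> of \<open>exp (L ^ d * p) = Z f\<close>; a weighting function has \<open>Z f > 0\<close>.\<close>

definition pressure :: "nat \<Rightarrow> (int ^ 'd \<Rightarrow> int ^ 'd \<Rightarrow> real) \<Rightarrow> real" where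
  "pressure L f = ln (partition_function L f) / real (L ^ CARD('d))"

definition constant_weighting :: "nat \<Rightarrow> int ^ 'd \<Rightarrow> int ^ 'd \<Rightarrow> real" where
  "constant_weighting N = (\<lambda>x y. 1 / real N)"

text \<open>The minimum in the definition of \<open>smoothness\<close> is attained for every weighting function.\<close>

lemma periodic_nat:
  fixes g :: "int ^ 'd \<Rightarrow> real"
  assumes "\<And>z i. g (z + axis i (int L)) = g z"
  shows "g (z + axis i (int L * int k)) = g z"
proof (induction k)
  case 0
  have "z + axis i (int L * int 0) = z" by (simp add: vec_eq_iff axis_def)
  then show ?case by (simp only:)
next
  case (Suc k)
  have "z + axis i (int L * int (Suc k)) = (z + axis i (int L * int k)) + axis i (int L)"
    by (simp add: vec_eq_iff axis_def algebra_simps)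
  then show ?case using assms Suc by (simp only:)
qed

lemma periodic_int:
  fixes g :: "int ^ 'd \<Rightarrow> real"
  assumes "\<And>z i. g (z + axis i (int L)) = g z"
  shows "g (z + axis i (int L * k)) = g z"
proof (cases "k \<ge> 0")
  case True
  then show ?thesis using periodic_nat[of g L z i "nat k"] assms by simp
next
  case False
  have "(z + axis i (int L * k)) + axis i (int L * int (nat (- k))) = z"
    using False by (simp add: vec_eq_iff axis_def)
  then show ?thesis
    using periodic_nat[of g L "z + axis i (int L * k)" i "nat (- k)", OF assms] by (simp only:)
qed

lemma periodic_mod:
  fixes g :: "int ^ 'd \<Rightarrow> real"
  assumes per: "\<And>z i. g (z + axis i (int L)) = g z"
  shows "g (\<chi> i. z $ i mod int L) = g z"
proof -
  have "g (\<chi> i. if i \<in> S then z $ i mod int L else z $ i) = g z" if "finite S" for S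
    using that
  proof (induction S rule: finite_induct)
    case empty
    then show ?case by simp
  next
    case (insert j S)
    let ?w = "\<lambda>S. (\<chi> i. if i \<in> S then z $ i mod int L else z $ i)"
    have "?w S = ?w (insert j S) + axis j (int L * (z $ j div int L))"
      using insert.hyps by (auto simp: vec_eq_iff axis_def)
    then have "g (?w S) = g (?w (insert j S))" by (simp only: periodic_int[of g L, OF per])
    then show ?case using insert.IH by simp
  qed
  from this[of UNIV] show ?thesis by simp
qed

lemma finite_torus: "finite (torus L :: (int ^ 'd) set)"
proof -
  have "(torus L :: (int ^ 'd) set) \<subseteq> vec_lambda ` (UNIV \<rightarrow>\<^sub>E {0..<int L})"
  proof
    fix x :: "int ^ 'd" assume "x \<in> torus L"
    then have "vec_nth x \<in> UNIV \<rightarrow>\<^sub>E {0..<int L}" by (auto simp: torus_def)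
    then show "x \<in> vec_lambda ` (UNIV \<rightarrow>\<^sub>E {0..<int L})"
      by (intro image_eqI[of _ _ "vec_nth x"]) simp_all
  qed
  then show ?thesis by (rule finite_subset) (simp add: finite_PiE)
qed

lemma smoothness_attained:
  fixes f :: "int ^ 'd \<Rightarrow> int ^ 'd \<Rightarrow> real"
  assumes "L > 0" and f: "weighting L f"
  shows "\<forall>x y. \<forall>u\<in>unit_vectors. \<bar>f x y - f x (y + u)\<bar> \<le> smoothness f * f x y"
    and "\<forall>x y. \<forall>u\<in>unit_vectors. \<bar>f x y - f x (y + u)\<bar> \<le> c * f x y \<Longrightarrow> smoothness f \<le> c"
proof -
  define r where "r z u = \<bar>f 0 z - f 0 (z + u)\<bar> / f 0 z" for z u
  define R where "R = (\<lambda>(z, u). r z u) ` (torus L \<times> unit_vectors)"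
  have pos: "f x y > 0" for x y using f by (simp add: weighting_def)
  have red: "f x y = f 0 (y - x)" for x y
  proof -
    have "f (0 + x) ((y - x) + x) = f 0 (y - x)" using f unfolding weighting_def by blast
    then show ?thesis by simp
  qed
  have "r (z + axis i (int L)) u = r z u" for z i u
  proof -
    have p: "f 0 (y + axis i (int L)) = f 0 y" for y using f by (simp add: weighting_def)
    have "z + axis i (int L) + u = (z + u) + axis i (int L)" by simp
    then show ?thesis by (simp only: r_def p)
  qed
  then have rmod: "r (\<chi> i. z $ i mod int L) u = r z u" for z u
    by (intro periodic_mod[of "\<lambda>z. r z u"])
  have "r z u \<in> R" if "u \<in> unit_vectors" for z u
  proof -
    have "(\<chi> i. z $ i mod int L) \<in> torus L" using \<open>L > 0\<close> by (simp add: torus_def)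
    then have "r (\<chi> i. z $ i mod int L) u \<in> R"
      unfolding R_def using that by (intro image_eqI[of _ _ "(_, u)"]) auto
    then show ?thesis by (simp only: rmod)
  qed
  then have R: "R = {r z u | z u. u \<in> unit_vectors}" by (auto simp: R_def)
  have "finite (unit_vectors :: (int ^ 'd) set)" by (simp add: unit_vectors_def)
  then have fin: "finite R" by (simp add: R_def finite_torus)
  have ne: "R \<noteq> {}" by (auto simp: R unit_vectors_def)
  have P: "(\<forall>x y. \<forall>u\<in>unit_vectors. \<bar>f x y - f x (y + u)\<bar> \<le> c * f x y) \<longleftrightarrow> Max R \<le> c" for c
  proof -
    have scaled: "\<bar>f x y - f x (y + u)\<bar> \<le> c * f x y \<longleftrightarrow> r (y - x) u \<le> c" for x y u
    proof -
      have "y + u - x = y - x + u" by simp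
      then show ?thesis
        by (simp only: r_def red[of x] pos_divide_le_eq[OF pos])
    qed
    have "(\<forall>x y. \<forall>u\<in>unit_vectors. \<bar>f x y - f x (y + u)\<bar> \<le> c * f x y) \<longleftrightarrow>
        (\<forall>z. \<forall>u\<in>unit_vectors. r z u \<le> c)"
      unfolding scaled
    proof (intro iffI allI)
      fix z assume "\<forall>x y. \<forall>u\<in>unit_vectors. r (y - x) u \<le> c"
      then have "\<forall>u\<in>unit_vectors. r (z - 0) u \<le> c" by blast
      then show "\<forall>u\<in>unit_vectors. r z u \<le> c" by (simp only: diff_zero)
    qed blast
    also have "\<dots> \<longleftrightarrow> Max R \<le> c" using fin ne by (auto simp: R)
    finally show ?thesis .
  qed
  have "smoothness f = Max R" unfolding smoothness_def P by (rule Least_equality) auto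
  then show "\<forall>x y. \<forall>u\<in>unit_vectors. \<bar>f x y - f x (y + u)\<bar> \<le> smoothness f * f x y"
    and "\<forall>x y. \<forall>u\<in>unit_vectors. \<bar>f x y - f x (y + u)\<bar> \<le> c * f x y \<Longrightarrow> smoothness f \<le> c"
    using P by simp_all
qed

end

theory Submission
  imports Defs "HOL-Analysis.Convex" "HOL-Computational_Algebra.Fundamental_Theorem_Algebra"
    "HOL-Real_Asymp.Real_Asymp"
begin

text \<open>The partition function is the permanent of the black-by-white matrix of \<open>f\<close>, which is doubly
  stochastic. By van der Waerden's inequality it is at least \<open>N! / N ^ N\<close>, so \<open>p f \<ge> p\<^sub>0\<close> without any
  smoothness; the inequality is proved by Gurvits' capacity argument.

  For the upper bound, a doubly stochastic matrix whose entries are at most \<open>1 / M\<close> has permanent at most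
  \<open>exp (- N (1 - o(1)))\<close> as \<open>M\<close> grows, by the entropy argument of Radhakrishnan: compare the distribution
  on matchings with the one in which the rows, in random order, choose free columns one after another.
  Smoothness forces small entries when \<open>L \<ge> 4 M\<close>, because \<open>f x\<close> is nearly constant along \<open>2 M\<close> sites of a
  line and sums to \<open>1\<close>. For the finitely many smaller \<open>L\<close> smoothness makes \<open>f\<close> nearly equal to \<open>1 / N\<close>.\<close>

section \<open>Permanents\<close>

definition bijs :: "'a set \<Rightarrow> 'b set \<Rightarrow> ('a \<Rightarrow> 'b) set" where
  "bijs A B = {\<sigma> \<in> A \<rightarrow>\<^sub>E B. bij_betw \<sigma> A B}"

definition permanent :: "'a set \<Rightarrow> 'b set \<Rightarrow> ('a \<Rightarrow> 'b \<Rightarrow> real) \<Rightarrow> real" where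
  "permanent A B w = (\<Sum>\<sigma>\<in>bijs A B. \<Prod>i\<in>A. w i (\<sigma> i))"

lemma finite_bijs: "finite A \<Longrightarrow> finite B \<Longrightarrow> finite (bijs A B)"
  unfolding bijs_def by (rule finite_subset[OF _ finite_PiE[of A "\<lambda>_. B"]]) auto

lemma bijs_empty: "bijs {} {} = {\<lambda>_. undefined}"
  by (auto simp: bijs_def bij_betw_def)

lemma bijs_nonempty:
  assumes "finite A" "finite B" "card A = card B"
  shows "bijs A B \<noteq> {}"
proof -
  obtain \<sigma> where "bij_betw \<sigma> A B"
    using finite_same_card_bij[OF assms] by blast
  then have "restrict \<sigma> A \<in> bijs A B"
    by (auto simp: bijs_def bij_betw_apply cong: bij_betw_cong)
  then show ?thesis by blast
qed

lemma sum_bijs_insert: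
  assumes "finite A" "finite B" "a \<notin> A"
  shows "(\<Sum>\<sigma>\<in>bijs (insert a A) B. F \<sigma>) = (\<Sum>b\<in>B. \<Sum>\<sigma>\<in>bijs A (B - {b}). F (\<sigma>(a := b)))"
proof -
  let ?S = "SIGMA b:B. bijs A (B - {b})"
  have upd: "bij_betw (\<lambda>(b, \<sigma>). \<sigma>(a := b)) ?S (bijs (insert a A) B)"
  proof (rule bij_betw_byWitness[where f' = "\<lambda>\<sigma>. (\<sigma> a, \<sigma>(a := undefined))"])
    show "\<forall>p\<in>?S. (\<lambda>\<sigma>. (\<sigma> a, \<sigma>(a := undefined))) (case p of (b, \<sigma>) \<Rightarrow> \<sigma>(a := b)) = p"
      using assms(3) by (auto simp: bijs_def PiE_def extensional_def fun_upd_idem_iff)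
    show "\<forall>\<sigma>\<in>bijs (insert a A) B. (\<lambda>(b, \<sigma>). \<sigma>(a := b)) (\<sigma> a, \<sigma>(a := undefined)) = \<sigma>"
      by auto
    show "(\<lambda>(b, \<sigma>). \<sigma>(a := b)) ` ?S \<subseteq> bijs (insert a A) B"
    proof clarify
      fix b \<sigma> assume b: "b \<in> B" and \<sigma>: "\<sigma> \<in> bijs A (B - {b})"
      have "bij_betw (\<sigma>(a := b)) A (B - {b})"
        using \<sigma> assms(3) by (subst bij_betw_cong[where g = \<sigma>]) (auto simp: bijs_def)
      then have "bij_betw (\<sigma>(a := b)) (insert a A) (insert ((\<sigma>(a := b)) a) (B - {b}))"
        using assms(3) by (subst notIn_Un_bij_betw3[symmetric, where A = A, simplified]) auto
      moreover have "\<sigma>(a := b) \<in> insert a A \<rightarrow>\<^sub>E B"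
        using \<sigma> b by (auto simp: bijs_def PiE_def extensional_def)
      ultimately show "\<sigma>(a := b) \<in> bijs (insert a A) B"
        using b by (simp add: bijs_def insert_absorb)
    qed
    show "(\<lambda>\<sigma>. (\<sigma> a, \<sigma>(a := undefined))) ` bijs (insert a A) B \<subseteq> ?S"
    proof clarify
      fix \<sigma> assume \<sigma>: "\<sigma> \<in> bijs (insert a A) B"
      then have bij: "bij_betw \<sigma> (insert a A) B" and ext: "\<sigma> \<in> insert a A \<rightarrow>\<^sub>E B"
        by (auto simp: bijs_def)
      have "bij_betw \<sigma> A (B - {\<sigma> a})"
        using bij assms(3) by (auto simp: bij_betw_def inj_on_def)
      then have "bij_betw (\<sigma>(a := undefined)) A (B - {\<sigma> a})"
        using assms(3) by (subst bij_betw_cong[where g = \<sigma>]) auto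
      moreover from this have "\<sigma>(a := undefined) \<in> A \<rightarrow>\<^sub>E (B - {\<sigma> a})"
        using ext assms(3) bij_betw_apply by (fastforce simp: PiE_def extensional_def)
      ultimately show "\<sigma> a \<in> B \<and> \<sigma>(a := undefined) \<in> bijs A (B - {\<sigma> a})"
        using ext by (auto simp: bijs_def)
    qed
  qed
  have "(\<Sum>b\<in>B. \<Sum>\<sigma>\<in>bijs A (B - {b}). F (\<sigma>(a := b))) = (\<Sum>p\<in>?S. F (case p of (b, \<sigma>) \<Rightarrow> \<sigma>(a := b)))"
    using assms by (subst sum.Sigma) (auto simp: finite_bijs intro!: sum.cong)
  also have "\<dots> = (\<Sum>\<sigma>\<in>bijs (insert a A) B. F \<sigma>)"
    by (rule sum.reindex_bij_betw[OF upd])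
  finally show ?thesis ..
qed

lemma permanent_insert:
  assumes "finite A" "finite B" "a \<notin> A"
  shows "permanent (insert a A) B w = (\<Sum>b\<in>B. w a b * permanent A (B - {b}) w)"
  unfolding permanent_def sum_bijs_insert[OF assms] sum_distrib_left
proof (intro sum.cong refl)
  fix b \<sigma>
  have "(\<Prod>i\<in>A. w i ((\<sigma>(a := b)) i)) = (\<Prod>i\<in>A. w i (\<sigma> i))"
    using assms(3) by (intro prod.cong) auto
  then show "(\<Prod>i\<in>insert a A. w i ((\<sigma>(a := b)) i)) = w a b * (\<Prod>i\<in>A. w i (\<sigma> i))"
    using assms by simp
qed

lemma permanent_const:
  assumes "finite A" "finite B" "card A = card B"
  shows "permanent A B (\<lambda>_ _. c) = fact (card A) * c ^ card A"
  using assms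
proof (induction A arbitrary: B rule: finite_induct)
  case empty
  then show ?case by (simp add: permanent_def bijs_empty)
next
  case (insert a A)
  have "permanent (insert a A) B (\<lambda>_ _. c) = (\<Sum>b\<in>B. c * (fact (card A) * c ^ card A))"
    unfolding permanent_insert[OF insert.hyps(1) insert.prems(1) insert.hyps(2)]
    using insert by (intro sum.cong refl) (simp add: card_Diff_singleton_if flip: insert.prems(2))
  also have "\<dots> = fact (Suc (card A)) * c ^ Suc (card A)"
    using insert by (simp flip: insert.prems(2))
  finally show ?case using insert.hyps by simp
qed

lemma permanent_mono:
  assumes "\<And>i j. i \<in> A \<Longrightarrow> j \<in> B \<Longrightarrow> 0 \<le> v i j \<and> v i j \<le> w i j"
  shows "permanent A B v \<le> permanent A B w"
  unfolding permanent_def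
  using assms by (intro sum_mono prod_mono) (auto simp: bijs_def)

lemma permanent_pos:
  assumes "finite A" "finite B" "card A = card B"
    and "\<And>i j. i \<in> A \<Longrightarrow> j \<in> B \<Longrightarrow> 0 < w i j"
  shows "0 < permanent A B w"
  unfolding permanent_def
  using assms by (intro sum_pos finite_bijs bijs_nonempty prod_pos) (auto simp: bijs_def)

section \<open>An entropy upper bound\<close>

text \<open>The summand is the probability of \<open>\<sigma>\<close> when the rows, by decreasing \<open>t\<close>, choose among the
  columns still free with probabilities proportional to \<open>w\<close>; ties in \<open>t\<close> only enlarge the
  denominators.\<close>

lemma sequential_choice_sum_le_1:
  fixes t :: "'a \<Rightarrow> nat" and w :: "'a \<Rightarrow> 'b \<Rightarrow> real"
  assumes "finite A" "finite B" "card A = card B"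
    and "\<And>i j. i \<in> A \<Longrightarrow> j \<in> B \<Longrightarrow> 0 < w i j"
  shows "(\<Sum>\<sigma>\<in>bijs A B. \<Prod>i\<in>A. w i (\<sigma> i) / (\<Sum>k\<in>{k \<in> A. t k \<le> t i}. w i (\<sigma> k))) \<le> 1"
  using assms
proof (induction A arbitrary: B rule: finite_ranking_induct[where f = t])
  case empty
  then show ?case by (simp add: bijs_empty)
next
  case (insert a A)
  show ?case
  proof (cases "a \<in> A")
    case True
    then show ?thesis using insert by (simp add: insert_absorb)
  next
    case a: False
    define Q where "Q A \<sigma> i = w i (\<sigma> i) / (\<Sum>k\<in>{k \<in> A. t k \<le> t i}. w i (\<sigma> k))" for A \<sigma> i
    define R where "R = (\<Sum>j\<in>B. w a j)"
    have B: "finite B" "B \<noteq> {}" using insert.prems a insert.hyps by auto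
    have R: "0 < R" unfolding R_def using insert.prems B by (intro sum_pos) auto
    have step: "(\<Sum>\<sigma>\<in>bijs A (B - {b}). \<Prod>i\<in>insert a A. Q (insert a A) (\<sigma>(a := b)) i) \<le> w a b / R"
      if b: "b \<in> B" for b
    proof -
      have "(\<Prod>i\<in>insert a A. Q (insert a A) (\<sigma>(a := b)) i) \<le> w a b / R * (\<Prod>i\<in>A. Q A \<sigma> i)"
        if \<sigma>: "\<sigma> \<in> bijs A (B - {b})" for \<sigma>
      proof -
        have bij: "bij_betw \<sigma> A (B - {b})" using \<sigma> by (simp add: bijs_def)
        have w: "0 < w i b" "k \<in> A \<Longrightarrow> 0 < w i (\<sigma> k)" if "i \<in> insert a A" for i k
          using insert.prems(3) that b bij_betw_apply[OF bij] by auto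
        have "{k \<in> insert a A. t k \<le> t a} = insert a A" using insert.hyps(2) by auto
        then have "(\<Sum>k\<in>{k \<in> insert a A. t k \<le> t a}. w a ((\<sigma>(a := b)) k)) =
            w a b + (\<Sum>k\<in>A. w a ((\<sigma>(a := b)) k))"
          using a insert.hyps by simp
        also have "(\<Sum>k\<in>A. w a ((\<sigma>(a := b)) k)) = (\<Sum>k\<in>A. w a (\<sigma> k))"
          using a by (intro sum.cong) auto
        also have "\<dots> = (\<Sum>j\<in>B - {b}. w a j)" by (rule sum.reindex_bij_betw[OF bij])
        finally have Qa: "Q (insert a A) (\<sigma>(a := b)) a = w a b / R"
          unfolding Q_def R_def using b B by (simp add: sum.remove[of B b])
        have "Q (insert a A) (\<sigma>(a := b)) i \<le> Q A \<sigma> i" if i: "i \<in> A" for i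
        proof -
          have "(\<Sum>k\<in>{k \<in> A. t k \<le> t i}. w i (\<sigma> k)) =
              (\<Sum>k\<in>{k \<in> A. t k \<le> t i}. w i ((\<sigma>(a := b)) k))"
            using a by (intro sum.cong) auto
          also have "\<dots> \<le> (\<Sum>k\<in>{k \<in> insert a A. t k \<le> t i}. w i ((\<sigma>(a := b)) k))"
            using w i insert.hyps(1) by (intro sum_mono2) (auto simp: less_imp_le)
          finally have le: "(\<Sum>k\<in>{k \<in> A. t k \<le> t i}. w i (\<sigma> k)) \<le> \<dots>" .
          have "0 < (\<Sum>k\<in>{k \<in> A. t k \<le> t i}. w i (\<sigma> k))"
            using w i insert.hyps(1) by (intro sum_pos) auto
          then show ?thesis unfolding Q_def using le w i a by (auto intro!: divide_left_mono mult_pos_pos simp: less_imp_le)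
        qed
        moreover have "0 \<le> Q (insert a A) (\<sigma>(a := b)) i" if "i \<in> A" for i
          unfolding Q_def using w that by (intro divide_nonneg_nonneg sum_nonneg) (auto simp: less_imp_le)
        ultimately have "(\<Prod>i\<in>A. Q (insert a A) (\<sigma>(a := b)) i) \<le> (\<Prod>i\<in>A. Q A \<sigma> i)"
          by (intro prod_mono) auto
        then show ?thesis
          using a insert.hyps(1) Qa R w(1)[of a]
          by (subst prod.insert) (auto intro!: mult_left_mono divide_right_mono)
      qed
      then have "(\<Sum>\<sigma>\<in>bijs A (B - {b}). \<Prod>i\<in>insert a A. Q (insert a A) (\<sigma>(a := b)) i) \<le>
          w a b / R * (\<Sum>\<sigma>\<in>bijs A (B - {b}). \<Prod>i\<in>A. Q A \<sigma> i)"
        unfolding sum_distrib_left by (rule sum_mono)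
      also have "\<dots> \<le> w a b / R * 1"
      proof (rule mult_left_mono)
        show "(\<Sum>\<sigma>\<in>bijs A (B - {b}). \<Prod>i\<in>A. Q A \<sigma> i) \<le> 1"
          unfolding Q_def using insert.prems insert.hyps a b by (intro insert.IH) auto
        show "0 \<le> w a b / R" using R insert.prems(3)[of a b] b by simp
      qed
      finally show ?thesis by simp
    qed
    have "(\<Sum>\<sigma>\<in>bijs (insert a A) B. \<Prod>i\<in>insert a A. Q (insert a A) \<sigma> i) \<le> (\<Sum>b\<in>B. w a b / R)"
      unfolding sum_bijs_insert[OF insert.hyps(1) B(1) a] using step by (rule sum_mono)
    also have "\<dots> = 1" using R by (simp add: R_def flip: sum_divide_distrib)
    finally show ?thesis unfolding Q_def .
  qed
qed

lemma card_functions_fixed_value: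
  assumes "finite A" "i \<in> A" "r < M"
  shows "card {t \<in> A \<rightarrow>\<^sub>E {..<M}. t i = r} = M ^ (card A - 1)"
proof -
  have "{t \<in> A \<rightarrow>\<^sub>E {..<M}. t i = r} = (\<Pi>\<^sub>E l\<in>A. if l = i then {r} else {..<M})"
    using assms by (fastforce simp: PiE_iff split: if_splits)
  then have "card {t \<in> A \<rightarrow>\<^sub>E {..<M}. t i = r} = (\<Prod>l\<in>A. card (if l = i then {r} else {..<M}))"
    using assms by (simp add: card_PiE)
  also have "\<dots> = (\<Prod>l\<in>A - {i}. M)"
    using assms by (simp add: prod.remove[of A i])
  finally show ?thesis using assms by simp
qed

lemma card_functions_fixed_value_le:
  assumes "finite A" "i \<in> A" "k \<in> A" "k \<noteq> i" "r < M"
  shows "M * card {t \<in> A \<rightarrow>\<^sub>E {..<M}. t i = r \<and> t k \<le> r} = M ^ (card A - 1) * Suc r"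
proof -
  have "{t \<in> A \<rightarrow>\<^sub>E {..<M}. t i = r \<and> t k \<le> r} =
      (\<Pi>\<^sub>E l\<in>A. if l = i then {r} else if l = k then {..r} else {..<M})"
    using assms by (fastforce simp: PiE_iff split: if_splits)
  then have "card {t \<in> A \<rightarrow>\<^sub>E {..<M}. t i = r \<and> t k \<le> r} =
      (\<Prod>l\<in>A. card (if l = i then {r} else if l = k then {..r} else {..<M}))"
    using assms by (simp add: card_PiE)
  also have "\<dots> = Suc r * (\<Prod>l\<in>A - {i} - {k}. M)"
    using assms by (simp add: prod.remove[of A i] prod.remove[of "A - {i}" k])
  also have "(\<Prod>l\<in>A - {i} - {k}. M) = M ^ (card A - 2)"
    using assms by (simp add: numeral_2_eq_2)
  moreover have "card A - 1 = Suc (card A - 2)"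
    using assms card_mono[of A "{i, k}"] by simp
  ultimately show ?thesis by (simp only: power_Suc) (simp add: algebra_simps)
qed

lemma sum_ln_early_weight_le:
  fixes v :: "'a \<Rightarrow> real"
  assumes A: "finite A" "i \<in> A" and M: "0 < M"
    and v: "\<And>k. k \<in> A \<Longrightarrow> 0 < v k" "(\<Sum>k\<in>A. v k) = 1" "v i \<le> 1 / real M"
  shows "(\<Sum>t\<in>A \<rightarrow>\<^sub>E {..<M}. ln (\<Sum>k\<in>{k \<in> A. t k \<le> t i}. v k)) \<le>
    real M ^ (card A - 1) * (\<Sum>r<M. ln (real (r + 2) / real M))"
proof -
  let ?T = "A \<rightarrow>\<^sub>E {..<M}"
  let ?n = "real M ^ (card A - 1)"
  define S where "S t = (\<Sum>k\<in>{k \<in> A. t k \<le> t i}. v k)" for t :: "'a \<Rightarrow> nat"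
  have finT: "finite ?T" using A by (intro finite_PiE) auto
  have level: "(\<Sum>t\<in>{t \<in> ?T. t i = r}. ln (S t)) \<le> ?n * ln (real (r + 2) / real M)" if r: "r < M" for r
  proof -
    let ?Tr = "{t \<in> ?T. t i = r}"
    define c where "c = real (r + 2) / real M"
    have c: "0 < c" using M by (simp add: c_def)
    have card_Tr: "real (card ?Tr) = ?n"
      using card_functions_fixed_value[OF A r] by simp
    have "(\<Sum>t\<in>?Tr. S t) = (\<Sum>t\<in>?Tr. \<Sum>k\<in>A. if t k \<le> r then v k else 0)"
      using A(1) by (intro sum.cong refl) (auto simp: S_def sum.inter_filter)
    also have "\<dots> = (\<Sum>k\<in>A. \<Sum>t\<in>?Tr. if t k \<le> r then v k else 0)"
      by (rule sum.swap)
    also have "\<dots> = (\<Sum>k\<in>A. v k * real (card {t \<in> ?T. t i = r \<and> t k \<le> r}))"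
    proof (intro sum.cong refl)
      fix k
      have "(\<Sum>t\<in>?Tr. if t k \<le> r then v k else 0) = (\<Sum>t\<in>{t \<in> ?Tr. t k \<le> r}. v k)"
        using finT by (intro sum.inter_filter[symmetric]) auto
      also have "{t \<in> ?Tr. t k \<le> r} = {t \<in> ?T. t i = r \<and> t k \<le> r}" by auto
      finally show "(\<Sum>t\<in>?Tr. if t k \<le> r then v k else 0) =
          v k * real (card {t \<in> ?T. t i = r \<and> t k \<le> r})" by simp
    qed
    also have "\<dots> = v i * ?n + (\<Sum>k\<in>A - {i}. v k * (?n * real (r + 1) / real M))"
    proof -
      have "{t \<in> ?T. t i = r \<and> t i \<le> r} = ?Tr" by auto
      moreover have "real (card {t \<in> ?T. t i = r \<and> t k \<le> r}) = ?n * real (r + 1) / real M"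
        if "k \<in> A - {i}" for k
      proof -
        have "real (M * card {t \<in> ?T. t i = r \<and> t k \<le> r}) = real (M ^ (card A - 1) * Suc r)"
          using card_functions_fixed_value_le[OF A, of k r M] that r by (intro arg_cong[where f = real]) auto
        then show ?thesis using M by (simp add: field_simps)
      qed
      ultimately show ?thesis using A card_Tr by (simp add: sum.remove[of A i])
    qed
    also have "\<dots> = v i * ?n + (1 - v i) * (?n * real (r + 1) / real M)"
    proof -
      have "(\<Sum>k\<in>A - {i}. v k) = 1 - v i"
        using A v(2) by (simp add: sum.remove[of A i])
      then show ?thesis by (simp only: flip: sum_distrib_right)
    qed
    also have "\<dots> \<le> (1 / real M) * ?n + 1 * (?n * real (r + 1) / real M)"
      using v(3) v(1)[OF A(2)] by (intro add_mono mult_right_mono) auto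
    also have "\<dots> = ?n * c" using M by (simp add: c_def divide_simps) (simp add: algebra_simps)
    finally have mean: "(\<Sum>t\<in>?Tr. S t) \<le> ?n * c" .
    have tangent: "ln (S t) \<le> ln c + (S t / c - 1)" if "t \<in> ?Tr" for t
    proof -
      have "0 < S t" unfolding S_def using A v(1) by (intro sum_pos) auto
      then show ?thesis using ln_le_minus_one[of "S t / c"] c by (simp add: ln_div)
    qed
    have "(\<Sum>t\<in>?Tr. ln (S t)) \<le> (\<Sum>t\<in>?Tr. ln c + (S t / c - 1))"
      by (intro sum_mono tangent)
    also have "\<dots> = ?n * ln c + ((\<Sum>t\<in>?Tr. S t) / c - ?n)"
      by (simp add: sum.distrib sum_subtractf card_Tr sum_divide_distrib)
    also have "\<dots> \<le> ?n * ln c" using mean c by (simp add: field_simps)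
    finally show ?thesis by (simp add: c_def)
  qed
  have "(\<Sum>t\<in>?T. ln (S t)) = (\<Sum>r<M. \<Sum>t\<in>{t \<in> ?T. t i = r}. ln (S t))"
    using finT A by (intro sum.group[symmetric]) auto
  also have "\<dots> \<le> (\<Sum>r<M. ?n * ln (real (r + 2) / real M))"
    using level by (intro sum_mono) auto
  finally show ?thesis by (simp add: S_def sum_distrib_left)
qed

lemma ln_permanent_le:
  fixes w :: "'a \<Rightarrow> 'b \<Rightarrow> real"
  assumes AB: "finite A" "finite B" "card A = card B" and M: "0 < M"
    and pos: "\<And>i j. i \<in> A \<Longrightarrow> j \<in> B \<Longrightarrow> 0 < w i j"
    and row: "\<And>i. i \<in> A \<Longrightarrow> (\<Sum>j\<in>B. w i j) = 1"
    and small: "\<And>i j. i \<in> A \<Longrightarrow> j \<in> B \<Longrightarrow> w i j \<le> 1 / real M"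
  shows "ln (permanent A B w) \<le> real (card A) * ((\<Sum>r<M. ln (real (r + 2) / real M)) / real M)"
proof (cases "A = {}")
  case True
  then show ?thesis using AB by (simp add: permanent_def bijs_empty)
next
  case False
  let ?T = "A \<rightarrow>\<^sub>E {..<M}"
  define Z where "Z = permanent A B w"
  define W where "W \<sigma> = (\<Prod>i\<in>A. w i (\<sigma> i))" for \<sigma>
  define S where "S t \<sigma> i = (\<Sum>k\<in>{k \<in> A. t k \<le> t i}. w i (\<sigma> k))" for t :: "'a \<Rightarrow> nat" and \<sigma> i
  define C where "C = (\<Sum>r<M. ln (real (r + 2) / real M))"
  have Z: "0 < Z" unfolding Z_def using AB pos by (rule permanent_pos)
  have Z_sum: "Z = (\<Sum>\<sigma>\<in>bijs A B. W \<sigma>)" by (simp add: Z_def permanent_def W_def)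
  have ws: "0 < w i (\<sigma> k)" if "\<sigma> \<in> bijs A B" "i \<in> A" "k \<in> A" for \<sigma> i k
    using that pos by (auto simp: bijs_def)
  have Wpos: "0 < W \<sigma>" if "\<sigma> \<in> bijs A B" for \<sigma>
    unfolding W_def using ws[OF that] by (intro prod_pos) auto
  have Spos: "0 < S t \<sigma> i" if "\<sigma> \<in> bijs A B" "i \<in> A" for t \<sigma> i
    unfolding S_def using ws[OF that(1)] that(2) AB by (intro sum_pos) auto
  \<comment> \<open>Gibbs' inequality, comparing \<open>W / Z\<close> with the law of the sequential choice.\<close>
  have gibbs: "Z * ln Z \<le> (\<Sum>\<sigma>\<in>bijs A B. W \<sigma> * (\<Sum>i\<in>A. ln (S t \<sigma> i)))" for t
  proof -
    have "W \<sigma> * (ln Z - (\<Sum>i\<in>A. ln (S t \<sigma> i))) \<le> Z * (\<Prod>i\<in>A. w i (\<sigma> i) / S t \<sigma> i) - W \<sigma>"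
      if \<sigma>: "\<sigma> \<in> bijs A B" for \<sigma>
    proof -
      define P where "P = (\<Prod>i\<in>A. S t \<sigma> i)"
      have P: "0 < P" unfolding P_def using Spos[OF \<sigma>] by (intro prod_pos) auto
      have "ln P = (\<Sum>i\<in>A. ln (S t \<sigma> i))"
        unfolding P_def using Spos[OF \<sigma>] AB by (intro ln_prod) (auto simp: less_le)
      then have "ln Z - (\<Sum>i\<in>A. ln (S t \<sigma> i)) \<le> Z / P - 1"
        using ln_le_minus_one[of "Z / P"] Z P by (simp add: ln_div)
      then have "W \<sigma> * (ln Z - (\<Sum>i\<in>A. ln (S t \<sigma> i))) \<le> W \<sigma> * (Z / P - 1)"
        using Wpos[OF \<sigma>] by (intro mult_left_mono) auto
      also have "\<dots> = Z * (\<Prod>i\<in>A. w i (\<sigma> i) / S t \<sigma> i) - W \<sigma>"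
        by (simp add: W_def P_def prod_dividef algebra_simps)
      finally show ?thesis .
    qed
    then have "(\<Sum>\<sigma>\<in>bijs A B. W \<sigma> * (ln Z - (\<Sum>i\<in>A. ln (S t \<sigma> i)))) \<le>
        (\<Sum>\<sigma>\<in>bijs A B. Z * (\<Prod>i\<in>A. w i (\<sigma> i) / S t \<sigma> i) - W \<sigma>)"
      by (rule sum_mono)
    also have "\<dots> = Z * (\<Sum>\<sigma>\<in>bijs A B. \<Prod>i\<in>A. w i (\<sigma> i) / S t \<sigma> i) - Z"
      by (simp add: sum_subtractf Z_sum sum_distrib_left)
    also have "\<dots> \<le> Z * 1 - Z"
      unfolding S_def using sequential_choice_sum_le_1[of A B w t, OF AB pos] Z
      by (intro diff_right_mono mult_left_mono) auto
    finally show ?thesis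
      by (simp add: algebra_simps sum_subtractf Z_sum sum_distrib_left sum_distrib_right)
  qed
  \<comment> \<open>The bound holds for every \<open>t\<close>; averaging over independent uniform times makes it explicit.\<close>
  have "real (card ?T) * (Z * ln Z) = (\<Sum>t\<in>?T. Z * ln Z)" by simp
  also have "\<dots> \<le> (\<Sum>t\<in>?T. \<Sum>\<sigma>\<in>bijs A B. W \<sigma> * (\<Sum>i\<in>A. ln (S t \<sigma> i)))"
    by (intro sum_mono gibbs)
  also have "\<dots> = (\<Sum>\<sigma>\<in>bijs A B. \<Sum>t\<in>?T. W \<sigma> * (\<Sum>i\<in>A. ln (S t \<sigma> i)))"
    by (rule sum.swap)
  also have "\<dots> = (\<Sum>\<sigma>\<in>bijs A B. W \<sigma> * (\<Sum>t\<in>?T. \<Sum>i\<in>A. ln (S t \<sigma> i)))"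
    by (simp add: sum_distrib_left)
  also have "\<dots> = (\<Sum>\<sigma>\<in>bijs A B. W \<sigma> * (\<Sum>i\<in>A. \<Sum>t\<in>?T. ln (S t \<sigma> i)))"
    by (subst sum.swap) simp
  also have "\<dots> \<le> (\<Sum>\<sigma>\<in>bijs A B. W \<sigma> * (\<Sum>i\<in>A. real M ^ (card A - 1) * C))"
  proof (intro sum_mono mult_left_mono)
    fix \<sigma> i assume \<sigma>: "\<sigma> \<in> bijs A B" and i: "i \<in> A"
    have "(\<Sum>k\<in>A. w i (\<sigma> k)) = 1"
      using sum.reindex_bij_betw[of \<sigma> A B "w i"] \<sigma> row[OF i] by (simp add: bijs_def)
    moreover have "\<sigma> i \<in> B" using \<sigma> i by (auto simp: bijs_def)
    ultimately show "(\<Sum>t\<in>?T. ln (S t \<sigma> i)) \<le> real M ^ (card A - 1) * C"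
      unfolding S_def C_def using ws[OF \<sigma> i] small[OF i] AB i M
      by (intro sum_ln_early_weight_le) auto
  qed (use Wpos in \<open>auto simp: less_imp_le\<close>)
  also have "\<dots> = Z * (real (card A) * (real M ^ (card A - 1) * C))"
    by (simp add: Z_sum sum_distrib_right)
  finally have "Z * (real (card ?T) * ln Z) \<le> Z * (real (card A) * (real M ^ (card A - 1) * C))"
    by (simp add: mult_ac)
  then have "real (card ?T) * ln Z \<le> real (card A) * (real M ^ (card A - 1) * C)"
    using Z by simp
  moreover have "real (card ?T) = real M * real M ^ (card A - 1)"
    using AB False power_eq_if[of "real M" "card A"] by (auto simp: card_PiE)
  ultimately have "real M ^ (card A - 1) * (real M * ln Z) \<le> real M ^ (card A - 1) * (real (card A) * C)"
    by (simp add: mult_ac)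
  then have "real M * ln Z \<le> real (card A) * C" using M by simp
  then show ?thesis using M by (simp add: Z_def C_def field_simps)
qed

section \<open>Van der Waerden's lower bound\<close>

text \<open>The partial derivatives along the coordinates \<open>C\<close> of the product over \<open>i \<in> I\<close> of the linear
  forms \<open>\<Sum>j. a j i * z j\<close>, expanded by the product rule; \<open>deriv_poly\<close> is the restriction of this
  polynomial to the line through \<open>z\<close> in direction \<open>d\<close>.\<close>

primrec deriv_forms :: "('c \<Rightarrow> 'i \<Rightarrow> 'a) \<Rightarrow> 'c set \<Rightarrow> 'c list \<Rightarrow> 'i set \<Rightarrow> ('c \<Rightarrow> 'a::comm_semiring_1) \<Rightarrow> 'a" where
  "deriv_forms a J [] I z = (\<Prod>i\<in>I. \<Sum>j\<in>J. a j i * z j)"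
| "deriv_forms a J (c # C) I z = (\<Sum>i\<in>I. a c i * deriv_forms a J C (I - {i}) z)"

primrec deriv_poly :: "('c \<Rightarrow> 'i \<Rightarrow> 'a) \<Rightarrow> 'c set \<Rightarrow> ('c \<Rightarrow> 'a::comm_ring_1) \<Rightarrow> 'c \<Rightarrow> 'c list \<Rightarrow> 'i set \<Rightarrow> 'a poly" where
  "deriv_poly a J z d [] I = (\<Prod>i\<in>I. [:\<Sum>j\<in>J. a j i * z j, a d i:])"
| "deriv_poly a J z d (c # C) I = (\<Sum>i\<in>I. smult (a c i) (deriv_poly a J z d C (I - {i})))"

lemma deriv_forms_swap:
  "deriv_forms a J (c # d # C) I z = deriv_forms a J (d # c # C) I z" if "finite I"
proof -
  have "deriv_forms a J (c # d # C) I z =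
      (\<Sum>i\<in>I. \<Sum>k\<in>{k \<in> I. k \<noteq> i}. a c i * a d k * deriv_forms a J C (I - {i} - {k}) z)" for c d
    unfolding deriv_forms.simps sum_distrib_left mult.assoc by (intro sum.cong refl) auto
  note expand = this
  show ?thesis
    unfolding expand[of c d] expand[of d c]
  proof (subst sum.swap_restrict[OF that that], intro sum.cong refl)
    fix k i
    have "I - {i} - {k} = I - {k} - {i}" by auto
    then show "a c i * a d k * deriv_forms a J C (I - {i} - {k}) z =
        a d k * a c i * deriv_forms a J C (I - {k} - {i}) z"
      by (simp only: mult.commute)
  qed auto
qed

lemma poly_deriv_poly:
  assumes "finite I" "finite J" "d \<in> J"
  shows "poly (deriv_poly a J z d C I) t = deriv_forms a J C I (z(d := z d + t))"
  using assms(1)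
proof (induction C arbitrary: I)
  case Nil
  have "(\<Sum>j\<in>J. a j i * (z(d := z d + t)) j) = (\<Sum>j\<in>J. a j i * z j) + t * a d i" for i
    using assms by (simp add: sum.remove[of J d] algebra_simps)
  then show ?case by (simp add: poly_prod)
next
  case (Cons c C)
  then show ?case by (simp add: poly_sum)
qed

lemma coeff_1_deriv_poly:
  assumes "finite I"
  shows "coeff (deriv_poly a J z d C I) 1 = deriv_forms a J (d # C) I z"
  using assms
proof (induction C arbitrary: I)
  case Nil
  then show ?case
  proof (induction I rule: finite_induct)
    case (insert i I)
    have c0: "coeff (\<Prod>i\<in>I. [:\<Sum>j\<in>J. a j i * z j, a d i:]) 0 = (\<Prod>i\<in>I. \<Sum>j\<in>J. a j i * z j)"
      by (simp add: poly_0_coeff_0[symmetric] poly_prod)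
    have "(\<Sum>k\<in>I. a d k * (\<Prod>i\<in>insert i I - {k}. \<Sum>j\<in>J. a j i * z j)) =
        (\<Sum>j\<in>J. a j i * z j) * (\<Sum>k\<in>I. a d k * (\<Prod>i\<in>I - {k}. \<Sum>j\<in>J. a j i * z j))"
      unfolding sum_distrib_left
    proof (intro sum.cong refl)
      fix k assume k: "k \<in> I"
      then have "insert i I - {k} = insert i (I - {k})" using insert.hyps by auto
      then show "a d k * (\<Prod>i\<in>insert i I - {k}. \<Sum>j\<in>J. a j i * z j) =
          (\<Sum>j\<in>J. a j i * z j) * (a d k * (\<Prod>i\<in>I - {k}. \<Sum>j\<in>J. a j i * z j))"
        using insert.hyps by (simp add: mult_ac)
    qed
    then show ?case using insert c0 by (simp add: algebra_simps)
  qed simp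
next
  case (Cons c C)
  have "coeff (deriv_poly a J z d (c # C) I) 1 = deriv_forms a J (c # d # C) I z"
    using Cons by (simp add: coeff_sum)
  then show ?case using deriv_forms_swap[OF Cons.prems] by simp
qed

lemma degree_deriv_poly_le:
  assumes "finite I" "length C \<le> card I"
  shows "degree (deriv_poly a J z d C I) \<le> card I - length C"
  using assms
proof (induction C arbitrary: I)
  case Nil
  have "degree (\<Prod>i\<in>I. [:\<Sum>j\<in>J. a j i * z j, a d i:]) \<le> (\<Sum>i\<in>I. degree [:\<Sum>j\<in>J. a j i * z j, a d i:])"
    using degree_prod_sum_le[OF Nil(1), of "\<lambda>i. [:\<Sum>j\<in>J. a j i * z j, a d i:]"] by (simp add: o_def)
  also have "\<dots> \<le> (\<Sum>i\<in>I. 1)" by (intro sum_mono) simp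
  finally show ?case by simp
next
  case (Cons c C)
  have "degree (deriv_poly a J z d C (I - {i})) \<le> card I - length (c # C)" if "i \<in> I" for i
    using Cons.IH[of "I - {i}"] Cons.prems that by simp
  then show ?case
    by (auto intro!: degree_sum_le[OF Cons.prems(1)] order.trans[OF degree_smult_le])
qed

lemma coeff_top_deriv_poly_pos:
  fixes a :: "'c \<Rightarrow> 'i \<Rightarrow> real"
  assumes "finite I" "length C \<le> card I" "d \<in> J" "set C \<subseteq> J" "\<And>j i. j \<in> J \<Longrightarrow> i \<in> I \<Longrightarrow> 0 < a j i"
  shows "\<exists>r>0. coeff (deriv_poly (\<lambda>j i. complex_of_real (a j i)) J z d C I) (card I - length C) = of_real r"
  using assms
proof (induction C arbitrary: I)
  case Nil
  have "coeff (\<Prod>i\<in>I. [:\<Sum>j\<in>J. complex_of_real (a j i) * z j, a d i:]) (card I) = (\<Prod>i\<in>I. of_real (a d i))"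
  proof -
    let ?l = "\<lambda>i. [:\<Sum>j\<in>J. complex_of_real (a j i) * z j, complex_of_real (a d i):]"
    have ad: "a d i \<noteq> 0" if "i \<in> I" for i
      using Nil.prems(5)[OF \<open>d \<in> J\<close> that] by simp
    then have "degree (\<Prod>i\<in>I. ?l i) = card I"
      by (subst degree_prod_sum_eq) auto
    moreover have "lead_coeff (\<Prod>i\<in>I. ?l i) = (\<Prod>i\<in>I. of_real (a d i))"
      unfolding lead_coeff_prod using ad by (intro prod.cong) auto
    ultimately show ?thesis by simp
  qed
  then show ?case using Nil.prems
    by (intro exI[of _ "\<Prod>i\<in>I. a d i"]) (auto intro!: prod_pos)
next
  case (Cons c C)
  let ?a = "\<lambda>j i. complex_of_real (a j i)"
  have "\<exists>r>0. coeff (deriv_poly ?a J z d C (I - {i})) (card I - length (c # C)) = of_real r" if "i \<in> I" for i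
    using Cons.IH[of "I - {i}"] Cons.prems that by simp
  then obtain r where r: "\<And>i. i \<in> I \<Longrightarrow> 0 < r i"
      "\<And>i. i \<in> I \<Longrightarrow> coeff (deriv_poly ?a J z d C (I - {i})) (card I - length (c # C)) = of_real (r i)"
    by metis
  have "I \<noteq> {}" using Cons.prems by auto
  then show ?case using Cons.prems r
    by (intro exI[of _ "\<Sum>i\<in>I. a c i * r i"]) (auto simp: coeff_sum intro!: sum_pos)
qed

lemma degree_deriv_poly:
  fixes a :: "'c \<Rightarrow> 'i \<Rightarrow> real"
  assumes "finite I" "length C \<le> card I" "d \<in> J" "set C \<subseteq> J" "\<And>j i. j \<in> J \<Longrightarrow> i \<in> I \<Longrightarrow> 0 < a j i"
  shows "degree (deriv_poly (\<lambda>j i. complex_of_real (a j i)) J z d C I) = card I - length C"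
proof (rule antisym)
  show "card I - length C \<le> degree (deriv_poly (\<lambda>j i. complex_of_real (a j i)) J z d C I)"
    using coeff_top_deriv_poly_pos[where a = a, OF assms, of z] by (intro le_degree) auto
qed (rule degree_deriv_poly_le[OF assms(1,2)])

lemma coeff_1_prod_linear:
  fixes u :: "nat \<Rightarrow> 'a::comm_ring_1"
  shows "coeff (\<Prod>i<n. [:1, u i:]) 1 = (\<Sum>i<n. u i)"
proof (induction n)
  case (Suc n)
  have "coeff (\<Prod>i<n. [:1, u i:]) 0 = 1"
    by (simp add: poly_0_coeff_0[symmetric] poly_prod)
  then show ?case using Suc by (simp add: algebra_simps)
qed simp

lemma complex_poly_normalized_factors:
  fixes p :: "complex poly"
  assumes "poly p 0 \<noteq> 0"
  obtains u where "p = smult (poly p 0) (\<Prod>i<degree p. [:1, u i:])"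
    and "\<And>i. i < degree p \<Longrightarrow> u i \<noteq> 0 \<and> poly p (- 1 / u i) = 0"
proof -
  obtain \<rho> where \<rho>: "smult (lead_coeff p) (\<Prod>i<degree p. [:- \<rho> i, 1:]) = p"
    by (rule complex_poly_decompose')
  have root: "poly p (\<rho> i) = 0" if "i < degree p" for i
    using that by (subst \<rho>[symmetric]) (auto simp: poly_prod)
  then have nz: "\<rho> i \<noteq> 0" if "i < degree p" for i using assms that by metis
  have "(\<Prod>i<degree p. [:- \<rho> i, 1:]) = (\<Prod>i<degree p. smult (- \<rho> i) [:1, - 1 / \<rho> i:])"
    using nz by (intro prod.cong) auto
  also have "\<dots> = smult (\<Prod>i<degree p. - \<rho> i) (\<Prod>i<degree p. [:1, - 1 / \<rho> i:])"
    by (rule prod_smult)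
  finally have eq: "p = smult (lead_coeff p * (\<Prod>i<degree p. - \<rho> i)) (\<Prod>i<degree p. [:1, - 1 / \<rho> i:])"
    by (subst \<rho>[symmetric]) simp
  have "poly p 0 = lead_coeff p * (\<Prod>i<degree p. - \<rho> i)"
    by (subst \<rho>[symmetric]) (simp add: poly_prod)
  with eq show ?thesis using nz root by (intro that[of "\<lambda>i. - 1 / \<rho> i"]) auto
qed

text \<open>Allowing purely imaginary coordinates, as long as they are not all so, makes the property of
  having no zeros here pass to derivatives without a limit argument.\<close>

definition half_space :: "'c set \<Rightarrow> ('c \<Rightarrow> complex) set" where
  "half_space J = {z. (\<forall>j\<in>J. 0 \<le> Re (z j)) \<and> (\<exists>j\<in>J. 0 < Re (z j))}"

lemma deriv_forms_nonzero:
  fixes a :: "'c \<Rightarrow> 'i \<Rightarrow> real"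
  assumes "finite I" "finite J" "length C \<le> card I" "set C \<subseteq> J"
    and "\<And>j i. j \<in> J \<Longrightarrow> i \<in> I \<Longrightarrow> 0 < a j i" and "z \<in> half_space J"
  shows "deriv_forms (\<lambda>j i. complex_of_real (a j i)) J C I z \<noteq> 0"
  using assms(3,4,6)
proof (induction C arbitrary: z)
  case Nil
  have "0 < Re (\<Sum>j\<in>J. of_real (a j i) * z j)" if i: "i \<in> I" for i
  proof -
    obtain k where "k \<in> J" "0 < Re (z k)" using Nil by (auto simp: half_space_def)
    then show ?thesis
      using assms(2) assms(5)[OF _ i] Nil(3)
      by (auto simp: half_space_def less_imp_le intro!: sum_pos2[of J k])
  qed
  then have "(\<Sum>j\<in>J. of_real (a j i) * z j) \<noteq> 0" if "i \<in> I" for i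
    using that by (metis less_irrefl zero_complex.simps(1))
  then show ?case using assms(1) by simp
next
  case (Cons c C)
  let ?a = "\<lambda>j i. complex_of_real (a j i)"
  let ?p = "deriv_poly ?a J z c C I"
  have deg: "degree ?p = card I - length C"
    using assms Cons.prems by (intro degree_deriv_poly) auto
  have nz: "poly ?p t \<noteq> 0" if "0 \<le> Re t" for t
  proof -
    have "z(c := z c + t) \<in> half_space J"
      using Cons.prems(3) that by (auto simp: half_space_def intro!: add_nonneg_nonneg add_pos_nonneg)
    then show ?thesis
      using poly_deriv_poly[OF assms(1,2), of c ?a z C t] Cons by simp
  qed
  then obtain u where u: "?p = smult (poly ?p 0) (\<Prod>i<degree ?p. [:1, u i:])"
      "\<And>i. i < degree ?p \<Longrightarrow> u i \<noteq> 0 \<and> poly ?p (- 1 / u i) = 0"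
    using complex_poly_normalized_factors[of ?p] by auto
  \<comment> \<open>Gauss--Lucas at the origin: all roots of \<open>?p\<close> lie in the open left half-plane.\<close>
  have "0 < Re (u i)" if "i < degree ?p" for i
  proof -
    have "Re (- 1 / u i) < 0" using nz[of "- 1 / u i"] u(2)[OF that] by force
    then have "0 < Re (u i) \<or> Re (u i) < 0 \<and> (Re (u i))\<^sup>2 + (Im (u i))\<^sup>2 < 0"
      by (simp add: Re_divide zero_less_divide_iff) blast
    moreover have "0 \<le> (Re (u i))\<^sup>2 + (Im (u i))\<^sup>2" by simp
    ultimately show ?thesis by linarith
  qed
  moreover have "0 < degree ?p" using deg Cons.prems by simp
  ultimately have "0 < Re (\<Sum>i<degree ?p. u i)"
    unfolding Re_sum by (intro sum_pos) (simp_all add: lessThan_empty_iff)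
  moreover have "coeff ?p 1 = poly ?p 0 * (\<Sum>i<degree ?p. u i)"
    by (subst u(1)) (simp only: coeff_smult coeff_1_prod_linear)
  moreover have "(\<Sum>i<degree ?p. u i) \<noteq> 0"
    using \<open>0 < Re (\<Sum>i<degree ?p. u i)\<close> by (metis less_irrefl zero_complex.simps(1))
  ultimately have "coeff ?p 1 \<noteq> 0" using nz[of 0] by (simp only: mult_eq_0_iff zero_complex.simps order.refl) simp
  then show ?case unfolding coeff_1_deriv_poly[OF assms(1)] .
qed

lemma deriv_forms_of_real:
  "deriv_forms (\<lambda>j i. complex_of_real (a j i)) J C I (\<lambda>j. of_real (x j)) = of_real (deriv_forms a J C I x)"
  by (induction C arbitrary: I) simp_all

lemma deriv_forms_scale:
  assumes "finite I" "length C \<le> card I"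
  shows "deriv_forms a J C I (\<lambda>j. \<omega> * z j) = \<omega> ^ (card I - length C) * deriv_forms a J C I z"
  using assms
proof (induction C arbitrary: I)
  case Nil
  have "(\<Sum>j\<in>J. a j i * (\<omega> * z j)) = \<omega> * (\<Sum>j\<in>J. a j i * z j)" for i
    by (simp add: sum_distrib_left mult_ac)
  then show ?case by (simp add: prod.distrib)
next
  case (Cons c C)
  have "a c i * deriv_forms a J C (I - {i}) (\<lambda>j. \<omega> * z j) =
      \<omega> ^ (card I - length (c # C)) * (a c i * deriv_forms a J C (I - {i}) z)" if "i \<in> I" for i
    using Cons.IH[of "I - {i}"] Cons.prems that by (simp add: mult_ac)
  then show ?case by (simp add: sum_distrib_left)
qed

lemma deriv_forms_nonneg:
  fixes a :: "'c \<Rightarrow> 'i \<Rightarrow> real"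
  assumes "set C \<subseteq> J" "\<And>j i. j \<in> J \<Longrightarrow> i \<in> I \<Longrightarrow> 0 \<le> a j i" "\<And>j. j \<in> J \<Longrightarrow> 0 \<le> x j"
  shows "0 \<le> deriv_forms a J C I x"
  using assms(1,2)
proof (induction C arbitrary: I)
  case Nil
  then show ?case using assms(3) by (auto intro!: prod_nonneg sum_nonneg)
next
  case (Cons c C)
  have "0 \<le> deriv_forms a J C (I - {i}) x" for i
    using Cons.prems by (intro Cons.IH) auto
  then show ?case using Cons.prems by (auto intro!: sum_nonneg mult_nonneg_nonneg)
qed

lemma deriv_forms_pos:
  fixes a :: "'c \<Rightarrow> 'i \<Rightarrow> real"
  assumes "finite I" "finite J" "J \<noteq> {}" "length C \<le> card I" "set C \<subseteq> J"
    and "\<And>j i. j \<in> J \<Longrightarrow> i \<in> I \<Longrightarrow> 0 < a j i" and "\<And>j. j \<in> J \<Longrightarrow> 0 < x j"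
  shows "0 < deriv_forms a J C I x"
proof -
  have "(\<lambda>j. complex_of_real (x j)) \<in> half_space J"
    using assms(3,7) by (auto simp: half_space_def less_imp_le)
  from deriv_forms_nonzero[where a = a, OF assms(1,2,4,5,6) this]
  have "deriv_forms a J C I x \<noteq> 0"
    by (simp add: deriv_forms_of_real)
  moreover have "0 \<le> deriv_forms a J C I x"
    using assms(5-7) by (intro deriv_forms_nonneg) (auto simp: less_imp_le)
  ultimately show ?thesis by simp
qed

lemma prod_le_mean_power:
  fixes y :: "'a \<Rightarrow> real"
  assumes "finite S" "S \<noteq> {}" "\<And>i. i \<in> S \<Longrightarrow> 0 < y i"
  shows "(\<Prod>i\<in>S. y i) \<le> ((\<Sum>i\<in>S. y i) / card S) ^ card S"
proof -
  have card: "0 < card S" using assms by (simp add: card_gt_0_iff)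
  have pos: "0 < (\<Prod>i\<in>S. y i)" using assms by (intro prod_pos) auto
  have "(\<Prod>i\<in>S. y i) = ((\<Prod>i\<in>S. y i) powr (1 / card S)) ^ card S"
    using pos card by (simp add: powr_powr flip: powr_realpow)
  also have "\<dots> \<le> (\<Sum>i\<in>S. y i / card S) ^ card S"
    using assms by (intro power_mono arith_geom_mean) (auto simp: less_imp_le)
  finally show ?thesis by (simp add: sum_divide_distrib)
qed

lemma deriv_forms_line_roots:
  fixes a :: "'c \<Rightarrow> 'i \<Rightarrow> real"
  assumes "finite I" "finite J" "d \<in> J" "length C \<le> card I" "set C \<subseteq> J"
    and "\<And>j i. j \<in> J \<Longrightarrow> i \<in> I \<Longrightarrow> 0 < a j i" and "\<And>j. j \<in> J \<Longrightarrow> 0 < x j"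
    and root: "poly (deriv_poly (\<lambda>j i. complex_of_real (a j i)) J (\<lambda>j. of_real (x j)) d C I) t = 0"
  shows "Im t = 0 \<and> Re t < 0"
proof (rule ccontr)
  assume neg: "\<not> (Im t = 0 \<and> Re t < 0)"
  let ?a = "\<lambda>j i. complex_of_real (a j i)"
  let ?z = "\<lambda>j. complex_of_real (x j)"
  \<comment> \<open>By homogeneity the point may be rotated into the half space.\<close>
  obtain \<omega> where \<omega>: "0 < Re \<omega>" "0 \<le> Re (\<omega> * t)"
  proof (cases "0 \<le> Re t")
    case True
    then show ?thesis using that[of 1] by simp
  next
    case False
    then have "Im t \<noteq> 0" using neg by auto
    then show ?thesis using that[of "Complex 1 (Re t / Im t)"] by simp
  qed
  have "(\<lambda>j. \<omega> * (?z(d := ?z d + t)) j) \<in> half_space J"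
  proof -
    have "0 < Re (\<omega> * (?z(d := ?z d + t)) j)" if "j \<in> J" for j
    proof -
      have "0 < Re \<omega> * x j" using \<omega>(1) assms(7)[OF that] by simp
      then show ?thesis using \<omega>(2) by (cases "j = d") (simp_all add: algebra_simps)
    qed
    then show ?thesis using \<open>d \<in> J\<close> by (auto simp: half_space_def less_imp_le)
  qed
  from deriv_forms_nonzero[where a = a, OF assms(1,2,4,5,6) this]
  have "deriv_forms ?a J C I (?z(d := ?z d + t)) \<noteq> 0"
    unfolding deriv_forms_scale[OF assms(1,4)] by (metis mult_zero_right)
  then show False using root poly_deriv_poly[OF assms(1-3), of ?a ?z C t] by simp
qed

lemma deriv_forms_line_le:
  fixes a :: "'c \<Rightarrow> 'i \<Rightarrow> real"
  assumes "finite I" "finite J" "d \<in> J" "length C < card I" "set C \<subseteq> J"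
    and "\<And>j i. j \<in> J \<Longrightarrow> i \<in> I \<Longrightarrow> 0 < a j i" and "\<And>j. j \<in> J \<Longrightarrow> 0 < x j" and "0 \<le> t"
  defines "k \<equiv> card I - length C"
  shows "deriv_forms a J C I (x(d := x d + t)) \<le>
    deriv_forms a J C I x * (1 + t * deriv_forms a J (d # C) I x / (k * deriv_forms a J C I x)) ^ k"
proof -
  let ?a = "\<lambda>j i. complex_of_real (a j i)"
  let ?z = "\<lambda>j. complex_of_real (x j)"
  define p where "p = deriv_poly ?a J ?z d C I"
  define R where "R = deriv_forms a J C I x"
  have R: "0 < R" unfolding R_def using assms by (intro deriv_forms_pos) auto
  have deg: "degree p = k" unfolding p_def k_def using assms by (intro degree_deriv_poly) auto
  have p_real: "poly p (of_real s) = of_real (deriv_forms a J C I (x(d := x d + s)))" for s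
  proof -
    have "?z(d := ?z d + of_real s) = (\<lambda>j. of_real ((x(d := x d + s)) j))" by auto
    then show ?thesis
      unfolding p_def poly_deriv_poly[OF assms(1-3)] by (simp only: deriv_forms_of_real)
  qed
  have p0: "poly p 0 = of_real R" using p_real[of 0] by (simp add: R_def)
  obtain u where u: "p = smult (poly p 0) (\<Prod>i<degree p. [:1, u i:])"
      "\<And>i. i < degree p \<Longrightarrow> u i \<noteq> 0 \<and> poly p (- 1 / u i) = 0"
    using complex_poly_normalized_factors[of p] p0 R by auto
  define v where "v i = Re (u i)" for i
  have v: "u i = of_real (v i)" "0 < v i" if "i < k" for i
  proof -
    have root: "poly p (- 1 / u i) = 0" using u(2)[of i] that deg by simp
    have "Im (- 1 / u i) = 0 \<and> Re (- 1 / u i) < 0"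
      using root[unfolded p_def] assms
      by (intro deriv_forms_line_roots[where a = a and x = x and d = d and C = C and I = I and J = J]) auto
    then have r: "- 1 / u i = of_real (Re (- 1 / u i))" "Re (- 1 / u i) < 0"
      by (auto simp: complex_eq_iff)
    define r where "r = Re (- 1 / u i)"
    have "u i = of_real (- 1 / r)"
      using r u(2)[of i] that unfolding deg r_def[symmetric] by (auto simp: field_simps)
    moreover have "0 < - 1 / r" using r unfolding r_def[symmetric] by (simp add: divide_neg_neg)
    ultimately show "u i = of_real (v i)" "0 < v i" by (simp_all add: v_def)
  qed
  have "complex_of_real (deriv_forms a J C I (x(d := x d + t))) =
      of_real R * (\<Prod>i<k. 1 + of_real t * u i)"
    unfolding p_real[symmetric] by (subst u(1)) (simp add: p0 deg poly_prod)
  also have "\<dots> = of_real (R * (\<Prod>i<k. 1 + t * v i))" using v by simp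
  finally have value_t: "deriv_forms a J C I (x(d := x d + t)) = R * (\<Prod>i<k. 1 + t * v i)"
    by (simp only: of_real_eq_iff)
  have "complex_of_real (deriv_forms a J (d # C) I x) = coeff p 1"
    unfolding p_def coeff_1_deriv_poly[OF assms(1)] deriv_forms_of_real ..
  also have "\<dots> = of_real R * (\<Sum>i<k. u i)"
    by (subst u(1)) (simp only: coeff_smult coeff_1_prod_linear p0 deg)
  also have "\<dots> = of_real (R * (\<Sum>i<k. v i))" using v by simp
  finally have deriv: "deriv_forms a J (d # C) I x = R * (\<Sum>i<k. v i)"
    by (simp only: of_real_eq_iff)
  have k: "0 < k" using assms by simp
  have "(\<Prod>i<k. 1 + t * v i) \<le> ((\<Sum>i<k. 1 + t * v i) / card {..<k}) ^ card {..<k}"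
    using v \<open>0 \<le> t\<close> k by (intro prod_le_mean_power) (auto intro!: add_pos_nonneg simp: less_imp_le)
  also have "(\<Sum>i<k. 1 + t * v i) / card {..<k} = 1 + t * deriv_forms a J (d # C) I x / (k * R)"
    using k R unfolding deriv by (simp add: sum.distrib field_simps flip: sum_distrib_left)
  finally show ?thesis
    using R by (simp add: value_t R_def[symmetric])
qed

lemma capacity_step:
  fixes G R0 R1 :: real
  assumes "0 < k" "0 < R0" "0 < R1"
    and le: "\<And>t. 0 < t \<Longrightarrow> G * t \<le> R0 * (1 + t * R1 / (real k * R0)) ^ k"
  shows "G * ((real k - 1) / real k) ^ (k - 1) \<le> R1"
proof (cases "k = 1")
  case True
  have lin: "G * t \<le> R0 + t * R1" if "0 < t" for t
  proof -
    have "R0 * (1 + t * R1 / (real k * R0)) ^ k = R0 + t * R1"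
      using True assms(2) by (simp add: field_simps)
    then show ?thesis using le[OF that] by simp
  qed
  have "G \<le> R1"
  proof (rule ccontr)
    assume "\<not> G \<le> R1"
    then have "(G - R1) * ((R0 + 1) / (G - R1)) \<le> R0"
      using lin[of "(R0 + 1) / (G - R1)"] assms(2) by (simp only: left_diff_distrib) (simp add: mult.commute)
    then show False using \<open>\<not> G \<le> R1\<close> by simp
  qed
  then show ?thesis using True by simp
next
  case False
  define q where "q = (real k - 1) / real k"
  have k: "1 < real k" using False assms(1) by simp
  have q: "0 < q" using k by (simp add: q_def)
  have "G * (R0 / (q * R1)) \<le> R0 * (1 / q) ^ k"
  proof -
    have "1 + R0 / (q * R1) * R1 / (real k * R0) = 1 / q"
      using assms k by (simp add: q_def field_simps)
    then show ?thesis using le[of "R0 / (q * R1)"] assms q by simp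
  qed
  then have "G \<le> (1 / q) ^ k * (q * R1)" using assms q by (simp add: field_simps)
  also have "\<dots> = (1 / q) ^ (k - 1) * R1" using q assms(1) by (cases k) auto
  finally have "G \<le> (1 / q) ^ (k - 1) * R1" .
  then show ?thesis using q by (simp add: q_def[symmetric] power_divide field_simps)
qed

lemma prod_forms_ge:
  fixes a :: "'c \<Rightarrow> 'i \<Rightarrow> real"
  assumes "finite I" "finite J" "\<And>j i. j \<in> J \<Longrightarrow> i \<in> I \<Longrightarrow> 0 < a j i" "\<And>j. j \<in> J \<Longrightarrow> 0 < x j"
    and "\<And>i. i \<in> I \<Longrightarrow> (\<Sum>j\<in>J. a j i) = 1" "\<And>j. j \<in> J \<Longrightarrow> (\<Sum>i\<in>I. a j i) = 1"
  shows "(\<Prod>j\<in>J. x j) \<le> (\<Prod>i\<in>I. \<Sum>j\<in>J. a j i * x j)"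
proof -
  have jensen: "(\<Sum>j\<in>J. a j i * ln (x j)) \<le> ln (\<Sum>j\<in>J. a j i * x j)" and pos: "0 < (\<Sum>j\<in>J. a j i * x j)"
    if i: "i \<in> I" for i
  proof -
    have ne: "J \<noteq> {}" using assms(5)[OF i] by auto
    show "0 < (\<Sum>j\<in>J. a j i * x j)" using assms ne i by (intro sum_pos) auto
    show "(\<Sum>j\<in>J. a j i * ln (x j)) \<le> ln (\<Sum>j\<in>J. a j i * x j)"
      using concave_on_sum[OF assms(2) ne ln_concave, of "\<lambda>j. a j i" x] assms i
      by (simp add: less_imp_le)
  qed
  have "ln (\<Prod>j\<in>J. x j) = (\<Sum>j\<in>J. (\<Sum>i\<in>I. a j i) * ln (x j))"
    using assms(2,4,6) by (subst ln_prod) (auto simp: less_le)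
  also have "\<dots> = (\<Sum>i\<in>I. \<Sum>j\<in>J. a j i * ln (x j))"
    by (subst sum.swap) (simp add: sum_distrib_right)
  also have "\<dots> \<le> (\<Sum>i\<in>I. ln (\<Sum>j\<in>J. a j i * x j))" by (intro sum_mono jensen)
  also have "\<dots> = ln (\<Prod>i\<in>I. \<Sum>j\<in>J. a j i * x j)"
    using assms(1) pos by (subst ln_prod) (auto simp: less_le)
  finally show ?thesis using assms(4) pos by (subst (asm) ln_le_cancel_iff) (auto intro!: prod_pos)
qed

lemma deriv_forms_ge:
  fixes a :: "'c \<Rightarrow> 'i \<Rightarrow> real"
  assumes "finite I" "finite J" "card I = card J" "\<And>j i. j \<in> J \<Longrightarrow> i \<in> I \<Longrightarrow> 0 < a j i"
    and "\<And>i. i \<in> I \<Longrightarrow> (\<Sum>j\<in>J. a j i) = 1" "\<And>j. j \<in> J \<Longrightarrow> (\<Sum>i\<in>I. a j i) = 1"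
    and "set C \<subseteq> J" "distinct C" "\<And>j. j \<in> J \<Longrightarrow> 0 < x j"
  shows "(\<Prod>k\<in>{card I - length C<..card I}. ((real k - 1) / real k) ^ (k - 1)) * (\<Prod>j\<in>J - set C. x j)
    \<le> deriv_forms a J C I x"
  using assms(7-9)
proof (induction C arbitrary: x)
  case Nil
  then show ?case using prod_forms_ge[OF assms(1,2,4) _ assms(5,6)] by simp
next
  case (Cons d C)
  define g where "g k = ((real k - 1) / real k) ^ (k - 1)" for k :: nat
  define k where "k = card I - length C"
  define G where "G = (\<Prod>k\<in>{k<..card I}. g k) * (\<Prod>j\<in>J - set (d # C). x j)"
  have len: "length C < card I"
    using Cons.prems assms(2,3) card_mono[of J "set (d # C)"] by (simp add: distinct_card)
  have d: "d \<in> J" "J \<noteq> {}" using Cons.prems by auto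
  have g: "0 \<le> g k" if "0 < k" for k using that by (simp add: g_def)
  have G: "0 \<le> G" unfolding G_def using g Cons.prems
    by (intro mult_nonneg_nonneg prod_nonneg) (auto simp: less_imp_le)
  have ge: "G * t \<le> deriv_forms a J C I (x(d := x d + t))" if t: "0 < t" for t
  proof -
    have "J - set (d # C) = J - set C - {d}" by auto
    then have "(\<Prod>j\<in>J - set C. (x(d := x d + t)) j) = (x d + t) * (\<Prod>j\<in>J - set (d # C). (x(d := x d + t)) j)"
      using prod.remove[of "J - set C" d "x(d := x d + t)"] assms(2) Cons.prems(1,2)
      by (simp only: fun_upd_same finite_Diff DiffI distinct.simps list.set insert_subset simp_thms)
    also have "(\<Prod>j\<in>J - set (d # C). (x(d := x d + t)) j) = (\<Prod>j\<in>J - set (d # C). x j)"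
      by (intro prod.cong) auto
    finally have split: "(\<Prod>j\<in>J - set C. (x(d := x d + t)) j) = (x d + t) * (\<Prod>j\<in>J - set (d # C). x j)" .
    have "G * t \<le> G * (x d + t)" using G Cons.prems(3)[OF d(1)] by (intro mult_left_mono) auto
    also have "\<dots> = (\<Prod>k\<in>{k<..card I}. g k) * (\<Prod>j\<in>J - set C. (x(d := x d + t)) j)"
      unfolding split G_def by (simp only: mult_ac)
    also have "\<dots> \<le> deriv_forms a J C I (x(d := x d + t))"
      unfolding g_def k_def
    proof (rule Cons.IH)
      show "0 < (x(d := x d + t)) j" if "j \<in> J" for j
        using Cons.prems(3)[OF that] t by auto
    qed (use Cons.prems in auto)
    finally show ?thesis .
  qed
  have "G * g k \<le> deriv_forms a J (d # C) I x"
    unfolding g_def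
  proof (rule capacity_step)
    show "0 < k" using len by (simp add: k_def)
    show "0 < deriv_forms a J C I x" "0 < deriv_forms a J (d # C) I x"
      using assms(1,2,4) Cons.prems len d by (intro deriv_forms_pos; auto)+
    show "G * t \<le> deriv_forms a J C I x *
        (1 + t * deriv_forms a J (d # C) I x / (real k * deriv_forms a J C I x)) ^ k" if "0 < t" for t
    proof -
      have "set C \<subseteq> J" using Cons.prems by auto
      from deriv_forms_line_le[OF assms(1,2) d(1) len this assms(4) Cons.prems(3) less_imp_le[OF that]]
      show ?thesis unfolding k_def by (rule order.trans[OF ge[OF that]])
    qed
  qed
  moreover have "{card I - length (d # C)<..card I} = insert k {k<..card I}"
    using len by (auto simp: k_def)
  ultimately show ?case by (simp add: G_def g_def mult_ac)
qed

lemma prod_capacity_constants: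
  "(\<Prod>k\<in>{0<..n}. ((real k - 1) / real k) ^ (k - 1)) = fact n / real n ^ n"
proof (induction n)
  case (Suc n)
  have "{0<..Suc n} = insert (Suc n) {0<..n}" by auto
  then show ?case using Suc by (cases "n = 0") (auto simp: power_divide)
qed simp

lemma deriv_forms_eq_permanent:
  assumes "finite I" "distinct C" "length C = card I"
  shows "deriv_forms a J C I x = permanent (set C) I a"
  using assms
proof (induction C arbitrary: I)
  case Nil
  then show ?case by (simp add: permanent_def bijs_empty)
next
  case (Cons c C)
  then show ?case by (auto simp: permanent_insert intro!: sum.cong)
qed

lemma van_der_Waerden_permanent:
  fixes a :: "'c \<Rightarrow> 'i \<Rightarrow> real"
  assumes "finite J" "finite I" "card J = card I" "\<And>j i. j \<in> J \<Longrightarrow> i \<in> I \<Longrightarrow> 0 < a j i"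
    and "\<And>j. j \<in> J \<Longrightarrow> (\<Sum>i\<in>I. a j i) = 1" "\<And>i. i \<in> I \<Longrightarrow> (\<Sum>j\<in>J. a j i) = 1"
  shows "fact (card J) / real (card J) ^ card J \<le> permanent J I a"
proof -
  obtain C where C: "set C = J" "distinct C" using finite_distinct_list[OF assms(1)] by blast
  have len: "length C = card I" using C assms(3) by (metis distinct_card)
  have "(\<Prod>k\<in>{card I - length C<..card I}. ((real k - 1) / real k) ^ (k - 1)) * (\<Prod>j\<in>J - set C. (1::real))
      \<le> deriv_forms a J C I (\<lambda>_. 1)"
    using assms C by (intro deriv_forms_ge) auto
  then show ?thesis
    using C len assms(3) deriv_forms_eq_permanent[OF assms(2) C(2) len, of a J "\<lambda>_. 1"]
    by (simp del: One_nat_def add: prod_capacity_constants)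
qed

section \<open>Weighted tilings of the torus\<close>

definition black_sites :: "nat \<Rightarrow> (int ^ 'd) set" where
  "black_sites L = {x \<in> torus L. black x}"

definition white_sites :: "nat \<Rightarrow> (int ^ 'd) set" where
  "white_sites L = {x \<in> torus L. \<not> black x}"

lemma finite_sites: "finite (black_sites L :: (int ^ 'd) set)" "finite (white_sites L :: (int ^ 'd) set)"
  by (simp_all add: black_sites_def white_sites_def finite_torus)

lemma card_torus: "card (torus L :: (int ^ 'd) set) = L ^ CARD('d)"
proof -
  have "bij_betw vec_nth (torus L :: (int ^ 'd) set) (UNIV \<rightarrow>\<^sub>E {0..<int L})"
    by (rule bij_betw_byWitness[where f' = vec_lambda]) (auto simp: torus_def PiE_iff)
  then have "card (torus L :: (int ^ 'd) set) = card ((UNIV :: 'd set) \<rightarrow>\<^sub>E {0..<int L})"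
    by (rule bij_betw_same_card)
  then show ?thesis by (simp add: card_PiE)
qed

lemma black_add_axis: "black (x + axis i (k :: int)) \<longleftrightarrow> (black x \<longleftrightarrow> even k)"
proof -
  have "(\<Sum>j\<in>UNIV. (x + axis i k) $ j) = (\<Sum>j\<in>UNIV. x $ j) + (\<Sum>j\<in>UNIV. if j = i then k else 0)"
    by (simp add: sum.distrib axis_def)
  also have "\<dots> = (\<Sum>j\<in>UNIV. x $ j) + k" by simp
  finally show ?thesis by (simp add: black_def)
qed

lemma card_sites:
  assumes L: "even L" "2 * N = L ^ CARD('d)"
  shows "card (black_sites L :: (int ^ 'd) set) = N" "card (white_sites L :: (int ^ 'd) set) = N"
proof -
  obtain i :: 'd where True by blast
  define flip where "flip x = x + axis i (if even (x $ i) then 1 else - 1)" for x :: "int ^ 'd"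
  have flip_flip: "flip (flip x) = x" for x
    by (auto simp: flip_def vec_eq_iff axis_def)
  have black_flip: "black (flip x) \<longleftrightarrow> \<not> black x" for x
    by (simp add: flip_def black_add_axis)
  have flip_torus: "flip x \<in> torus L" if "x \<in> torus L" for x
  proof -
    obtain m where m: "L = 2 * m" using L(1) by blast
    have "0 \<le> x $ i" "x $ i < int L" using that by (auto simp: torus_def)
    then have "0 \<le> x $ i + (if even (x $ i) then 1 else - 1)"
        "x $ i + (if even (x $ i) then 1 else - 1) < int L"
      unfolding m by (cases "even (x $ i)"; auto elim!: evenE oddE)+
    then have "0 \<le> flip x $ j \<and> flip x $ j < int L" for j
      using that by (cases "j = i") (simp_all add: torus_def flip_def axis_def)
    then show ?thesis by (simp add: torus_def)
  qed
  have "bij_betw flip (black_sites L) (white_sites L)"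
    by (rule bij_betw_byWitness[where f' = flip])
      (auto simp: black_sites_def white_sites_def flip_flip black_flip flip_torus)
  then have eq: "card (black_sites L :: (int ^ 'd) set) = card (white_sites L :: (int ^ 'd) set)"
    by (rule bij_betw_same_card)
  have "(torus L :: (int ^ 'd) set) = black_sites L \<union> white_sites L"
    by (auto simp: black_sites_def white_sites_def)
  then have "L ^ CARD('d) = card (black_sites L :: (int ^ 'd) set) + card (white_sites L :: (int ^ 'd) set)"
    unfolding card_torus[symmetric]
    by (simp only:) (rule card_Un_disjoint, auto simp: finite_sites, auto simp: black_sites_def white_sites_def)
  then show "card (black_sites L :: (int ^ 'd) set) = N" "card (white_sites L :: (int ^ 'd) set) = N"
    using eq L by simp_all
qed

lemma tilings_eq_image_bijs:
  assumes L: "even L" "0 < N" "2 * N = L ^ CARD('d)"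
  shows "bij_betw (\<lambda>\<sigma>. (\<lambda>x. {x, \<sigma> x}) ` black_sites L)
    (bijs (black_sites L) (white_sites L)) (tilings L :: (int ^ 'd) set set set)"
  unfolding bij_betw_def
proof
  let ?B = "black_sites L :: (int ^ 'd) set" and ?W = "white_sites L :: (int ^ 'd) set"
  let ?T = "\<lambda>\<sigma>. (\<lambda>x. {x, \<sigma> x}) ` ?B"
  note card = card_sites[OF L(1,3)]
  have pair: "x = x' \<and> y = y'" if "{x, y} = {x', y'}" "x \<in> ?B" "x' \<in> ?B" "y \<in> ?W" "y' \<in> ?W" for x y x' y'
    using that by (auto simp: black_sites_def white_sites_def doubleton_eq_iff)
  show "inj_on ?T (bijs ?B ?W)"
  proof (rule inj_onI)
    fix \<sigma> \<tau> assume \<sigma>: "\<sigma> \<in> bijs ?B ?W" and \<tau>: "\<tau> \<in> bijs ?B ?W" and eq: "?T \<sigma> = ?T \<tau>"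
    have maps: "\<sigma> x \<in> ?W" "\<tau> x \<in> ?W" if "x \<in> ?B" for x
      using \<sigma> \<tau> that by (auto simp: bijs_def)
    have "\<sigma> x = \<tau> x" if x: "x \<in> ?B" for x
    proof -
      have "{x, \<sigma> x} \<in> ?T \<tau>" using eq x by blast
      then obtain x' where "x' \<in> ?B" "{x, \<sigma> x} = {x', \<tau> x'}" by blast
      then show ?thesis using pair maps x by blast
    qed
    then show "\<sigma> = \<tau>" using \<sigma> \<tau> by (auto simp: bijs_def intro: PiE_ext)
  qed
  show "?T ` bijs ?B ?W = tilings L"
  proof (intro equalityI subsetI)
    fix T assume "T \<in> ?T ` bijs ?B ?W"
    then obtain \<sigma> where \<sigma>: "\<sigma> \<in> bijs ?B ?W" and T: "T = ?T \<sigma>" by blast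
    have maps: "\<sigma> x \<in> ?W" if "x \<in> ?B" for x using \<sigma> that by (auto simp: bijs_def)
    have inj: "inj_on \<sigma> ?B" using \<sigma> by (auto simp: bijs_def bij_betw_def)
    have "inj_on (\<lambda>x. {x, \<sigma> x}) ?B" using pair maps by (meson inj_onI)
    then have "card T = N" unfolding T by (simp add: card_image card)
    moreover have "disjoint T"
    proof (rule disjointI)
      fix e e' assume "e \<in> T" "e' \<in> T" "e \<noteq> e'"
      then obtain x x' where x: "x \<in> ?B" "x' \<in> ?B" "e = {x, \<sigma> x}" "e' = {x', \<sigma> x'}" "x \<noteq> x'"
        unfolding T by blast
      moreover from this have "\<sigma> x \<noteq> \<sigma> x'" using inj by (auto dest: inj_onD)
      ultimately show "e \<inter> e' = {}"
        using maps[OF x(1)] maps[OF x(2)] by (auto simp: black_sites_def white_sites_def)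
    qed
    moreover have "\<exists>x\<in>torus L. \<exists>y\<in>torus L. black x \<and> \<not> black y \<and> e = {x, y}" if "e \<in> T" for e
    proof -
      from that obtain x where "x \<in> ?B" "e = {x, \<sigma> x}" unfolding T by blast
      then show ?thesis using maps[of x] by (auto simp: black_sites_def white_sites_def)
    qed
    ultimately show "T \<in> tilings L" using L by (auto simp: tilings_def)
  next
    fix T :: "(int ^ 'd) set set" assume "T \<in> tilings L"
    then have T: "card T = N" "disjoint T"
        "\<And>e. e \<in> T \<Longrightarrow> \<exists>x\<in>?B. \<exists>y\<in>?W. e = {x, y}"
      using L by (auto simp: tilings_def black_sites_def white_sites_def Bex_def)
    then obtain b w where bw: "\<And>e. e \<in> T \<Longrightarrow> b e \<in> ?B \<and> w e \<in> ?W \<and> e = {b e, w e}" by metis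
    have fin: "finite T" using T(1) L(2) by (metis card.infinite less_irrefl)
    have eqI: "e = e'" if "e \<in> T" "e' \<in> T" "b e = b e' \<or> w e = w e'" for e e'
    proof (rule ccontr)
      assume "e \<noteq> e'"
      then have "e \<inter> e' = {}" using T(2) that by (auto simp: disjoint_def)
      then show False using bw[OF that(1)] bw[OF that(2)] that(3) by (metis disjoint_insert(1) insertI1 insertCI disjoint_iff)
    qed
    have "b ` T = ?B"
      using bw by (intro card_subset_eq finite_sites) (auto simp: card T(1) card_image inj_onI eqI)
    then have b: "bij_betw b T ?B" using eqI by (auto simp: bij_betw_def inj_on_def)
    have "w ` T = ?W"
      using bw by (intro card_subset_eq finite_sites) (auto simp: card T(1) card_image inj_onI eqI)
    then have w: "bij_betw w T ?W" using eqI by (auto simp: bij_betw_def inj_on_def)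
    define \<sigma> where "\<sigma> = restrict (w \<circ> the_inv_into T b) ?B"
    have "bij_betw (w \<circ> the_inv_into T b) ?B ?W"
      using b w by (intro bij_betw_trans[OF bij_betw_the_inv_into])
    then have "\<sigma> \<in> bijs ?B ?W"
      unfolding bijs_def \<sigma>_def by (auto intro: bij_betw_apply cong: bij_betw_cong)
    moreover have "T = ?T \<sigma>"
    proof -
      have "{b e, \<sigma> (b e)} = e" if "e \<in> T" for e
        using that bw[OF that] b by (simp add: \<sigma>_def bij_betw_def the_inv_into_f_f)
      then have "(\<lambda>e. {b e, \<sigma> (b e)}) ` T = T" by simp
      then show ?thesis using \<open>b ` T = ?B\<close> by (metis (no_types, lifting) image_image image_cong)
    qed
    ultimately show "T \<in> ?T ` bijs ?B ?W" by blast
  qed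
qed

lemma partition_function_eq_permanent:
  fixes f :: "int ^ 'd \<Rightarrow> int ^ 'd \<Rightarrow> real"
  assumes "even L" "0 < N" "2 * N = L ^ CARD('d)"
  shows "partition_function L f = permanent (black_sites L) (white_sites L) f"
proof -
  let ?B = "black_sites L :: (int ^ 'd) set" and ?W = "white_sites L :: (int ^ 'd) set"
  have "partition_function L f =
      (\<Sum>\<sigma>\<in>bijs ?B ?W. \<Prod>e\<in>(\<lambda>x. {x, \<sigma> x}) ` ?B. edge_weight f e)"
    unfolding partition_function_def by (rule sum.reindex_bij_betw[OF tilings_eq_image_bijs[OF assms], symmetric])
  also have "\<dots> = (\<Sum>\<sigma>\<in>bijs ?B ?W. \<Prod>x\<in>?B. f x (\<sigma> x))"
  proof (intro sum.cong refl)
    fix \<sigma> assume "\<sigma> \<in> bijs ?B ?W"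
    then have maps: "black x" "\<not> black (\<sigma> x)" if "x \<in> ?B" for x
      using that by (auto simp: bijs_def black_sites_def white_sites_def)
    then have "inj_on (\<lambda>x. {x, \<sigma> x}) ?B"
      by (auto simp: inj_on_def doubleton_eq_iff)
    then show "(\<Prod>e\<in>(\<lambda>x. {x, \<sigma> x}) ` ?B. edge_weight f e) = (\<Prod>x\<in>?B. f x (\<sigma> x))"
      using maps by (simp add: prod.reindex edge_weight_pair)
  qed
  finally show ?thesis by (simp add: permanent_def)
qed

lemma pressure_constant_weighting:
  assumes "even L" "0 < N" "2 * N = L ^ CARD('d)"
  shows "pressure L (constant_weighting N :: int ^ 'd \<Rightarrow> int ^ 'd \<Rightarrow> real) =
    (1 / (2 * real N)) * (ln (fact N) - real N * ln (real N))"
proof -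
  have "partition_function L (constant_weighting N :: int ^ 'd \<Rightarrow> int ^ 'd \<Rightarrow> real) = fact N * (1 / real N) ^ N"
    unfolding partition_function_eq_permanent[OF assms] constant_weighting_def
    using permanent_const[OF finite_sites[where 'd = 'd], of L L "1 / real N"] card_sites[where 'd = 'd, OF assms(1,3)] by simp
  moreover have "ln (fact N * (1 / real N) ^ N) = ln (fact N) - real N * ln (real N)"
    using assms(2) by (simp add: ln_mult ln_realpow ln_div)
  moreover have "real (L ^ CARD('d)) = 2 * real N" using assms(3) by (metis of_nat_mult of_nat_numeral)
  ultimately show ?thesis by (simp add: pressure_def)
qed

lemma weighting_sum_sites:
  fixes f :: "int ^ 'd \<Rightarrow> int ^ 'd \<Rightarrow> real"
  assumes "weighting L f"
  shows "black x \<Longrightarrow> (\<Sum>y\<in>white_sites L. f x y) = 1"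
    and "\<not> black y \<Longrightarrow> (\<Sum>x\<in>black_sites L. f x y) = 1"
proof -
  have sum: "(\<Sum>y\<in>{y \<in> torus L. opposite x y}. f x y) = 1" and sym: "f x y = f y x" for x y
    using assms unfolding weighting_def by blast+
  show "(\<Sum>y\<in>white_sites L. f x y) = 1" if "black x"
    using sum[of x] that by (simp add: opposite_def white_sites_def)
  show "(\<Sum>x\<in>black_sites L. f x y) = 1" if "\<not> black y"
    using sum[of y] that by (simp add: opposite_def black_sites_def sym[of _ y])
qed

lemma pressure_ge_constant:
  fixes f :: "int ^ 'd \<Rightarrow> int ^ 'd \<Rightarrow> real"
  assumes L: "even L" "0 < N" "2 * N = L ^ CARD('d)" and f: "weighting L f"
  shows "pressure L (constant_weighting N :: int ^ 'd \<Rightarrow> int ^ 'd \<Rightarrow> real) \<le> pressure L f"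
proof -
  let ?B = "black_sites L :: (int ^ 'd) set" and ?W = "white_sites L :: (int ^ 'd) set"
  note card = card_sites[where 'd = 'd, OF L(1,3)]
  have "fact (card ?B) / real (card ?B) ^ card ?B \<le> permanent ?B ?W f"
  proof (rule van_der_Waerden_permanent)
    show "0 < f x y" for x y using f by (simp add: weighting_def)
    show "(\<Sum>y\<in>?W. f x y) = 1" if "x \<in> ?B" for x
      using that by (intro weighting_sum_sites(1)[OF f]) (simp add: black_sites_def)
    show "(\<Sum>x\<in>?B. f x y) = 1" if "y \<in> ?W" for y
      using that by (intro weighting_sum_sites(2)[OF f]) (simp add: white_sites_def)
  qed (simp_all add: card finite_sites)
  then have le: "fact N / real N ^ N \<le> partition_function L f"
    by (simp add: card partition_function_eq_permanent[OF L])
  have "ln (fact N) - real N * ln (real N) = ln (fact N / real N ^ N)"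
    using L(2) by (simp add: ln_div ln_realpow)
  also have "\<dots> \<le> ln (partition_function L f)"
    using le L(2) by (intro ln_mono) auto
  finally have "(ln (fact N) - real N * ln (real N)) / (2 * real N) \<le> ln (partition_function L f) / (2 * real N)"
    by (intro divide_right_mono) auto
  moreover have "real (L ^ CARD('d)) = 2 * real N" using L(3) by (metis of_nat_mult of_nat_numeral)
  ultimately show ?thesis
    unfolding pressure_constant_weighting[OF L] unfolding pressure_def by simp
qed

lemma smooth_step:
  fixes f :: "int ^ 'd \<Rightarrow> int ^ 'd \<Rightarrow> real"
  assumes "0 < L" "weighting L f" "smoothness f < \<delta>"
  shows "(1 - \<delta>) * f x y \<le> f x (y + axis i 1)"
proof -
  have "axis i 1 \<in> (unit_vectors :: (int ^ 'd) set)" by (auto simp: unit_vectors_def)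
  then have "\<bar>f x y - f x (y + axis i 1)\<bar> \<le> smoothness f * f x y"
    using smoothness_attained(1)[OF assms(1,2)] by blast
  also have "\<dots> \<le> \<delta> * f x y"
    using assms(2,3) by (intro mult_right_mono) (auto simp: weighting_def less_imp_le)
  finally show ?thesis by (simp add: algebra_simps abs_le_iff)
qed

lemma smooth_line:
  fixes f :: "int ^ 'd \<Rightarrow> int ^ 'd \<Rightarrow> real"
  assumes "0 < L" "weighting L f" "smoothness f < \<delta>" "\<delta> \<le> 1"
  shows "(1 - \<delta>) ^ k * f x y \<le> f x (y + axis i (int k))"
proof (induction k)
  case 0
  have "y + axis i (int 0) = y" by (simp add: vec_eq_iff axis_def)
  then show ?case by (simp only: power_0)
next
  case (Suc k)
  have "(1 - \<delta>) ^ Suc k * f x y \<le> (1 - \<delta>) * f x (y + axis i (int k))"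
    using mult_left_mono[OF Suc, of "1 - \<delta>"] assms(4) by (simp add: mult_ac)
  also have "\<dots> \<le> f x ((y + axis i (int k)) + axis i 1)" by (rule smooth_step[OF assms(1-3)])
  also have "(y + axis i (int k)) + axis i 1 = y + axis i (int (Suc k))"
    by (simp add: vec_eq_iff axis_def)
  finally show ?case .
qed

lemma smooth_displacement:
  fixes f :: "int ^ 'd \<Rightarrow> int ^ 'd \<Rightarrow> real"
  assumes "0 < L" "weighting L f" "smoothness f < \<delta>" "0 \<le> \<delta>" "\<delta> \<le> 1"
  shows "(1 - \<delta>) ^ (L * CARD('d)) * f x y \<le> f x y'"
proof -
  have pos: "0 < f x z" for z using assms(2) by (simp add: weighting_def)
  define k where "k i = nat ((y' $ i - y $ i) mod int L)" for i
  have k: "k i \<le> L" "int (k i) = (y' $ i - y $ i) mod int L" for i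
    using assms(1) by (simp_all add: k_def nat_le_iff pos_mod_bound less_imp_le)
  have "(1 - \<delta>) ^ (L * card S) * f x y \<le> f x (\<chi> i. if i \<in> S then y $ i + int (k i) else y $ i)"
    if "finite S" for S :: "'d set"
    using that
  proof (induction S rule: finite_induct)
    case empty
    then show ?case by simp
  next
    case (insert j S)
    let ?y = "\<lambda>S. (\<chi> i. if i \<in> S then y $ i + int (k i) else y $ i)"
    have "(1 - \<delta>) ^ (L * card (insert j S)) * f x y = (1 - \<delta>) ^ L * ((1 - \<delta>) ^ (L * card S) * f x y)"
      using insert.hyps by (simp add: power_add)
    also have "\<dots> \<le> (1 - \<delta>) ^ L * f x (?y S)"
      using insert.IH assms by (intro mult_left_mono) auto
    also have "\<dots> \<le> (1 - \<delta>) ^ k j * f x (?y S)"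
      using k(1)[of j] assms pos by (intro mult_right_mono power_decreasing) (auto simp: less_imp_le)
    also have "\<dots> \<le> f x (?y S + axis j (int (k j)))"
      by (rule smooth_line[OF assms(1-3,5)])
    also have "?y S + axis j (int (k j)) = ?y (insert j S)"
      using insert.hyps by (auto simp: vec_eq_iff axis_def)
    finally show ?case .
  qed
  from this[of UNIV] have "(1 - \<delta>) ^ (L * CARD('d)) * f x y \<le> f x (\<chi> i. y $ i + int (k i))"
    by simp
  also have "\<dots> = f x (\<chi> i. (\<chi> i. y $ i + int (k i)) $ i mod int L)"
    using assms(2) by (intro periodic_mod[symmetric]) (auto simp: weighting_def)
  also have "(\<chi> i. (\<chi> i. y $ i + int (k i)) $ i mod int L) = (\<chi> i. y' $ i mod int L)"
    by (simp add: vec_eq_iff k(2) mod_simps)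
  also have "f x \<dots> = f x y'"
    using assms(2) by (intro periodic_mod) (auto simp: weighting_def)
  finally show ?thesis .
qed

lemma weight_le_near_uniform:
  fixes f :: "int ^ 'd \<Rightarrow> int ^ 'd \<Rightarrow> real"
  assumes L: "even L" "0 < L" "2 * N = L ^ CARD('d)"
    and f: "weighting L f" "smoothness f < \<delta>" "0 \<le> \<delta>" "\<delta> < 1" and "black x"
  shows "f x y \<le> 1 / (real N * (1 - \<delta>) ^ (L * CARD('d)))"
proof -
  have N: "0 < N" using L by (cases N) auto
  have "real N * ((1 - \<delta>) ^ (L * CARD('d)) * f x y) =
      (\<Sum>z\<in>(white_sites L :: (int ^ 'd) set). (1 - \<delta>) ^ (L * CARD('d)) * f x y)"
    by (simp add: card_sites(2)[where 'd = 'd, OF L(1,3)])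
  also have "\<dots> \<le> (\<Sum>z\<in>(white_sites L :: (int ^ 'd) set). f x z)"
    using f L by (intro sum_mono smooth_displacement) auto
  also have "\<dots> = 1" by (rule weighting_sum_sites(1)[OF f(1) \<open>black x\<close>])
  finally show ?thesis using N f by (simp add: field_simps)
qed

lemma black_mod:
  assumes "even L"
  shows "black (\<chi> i. z $ i mod int L) \<longleftrightarrow> black z"
proof -
  have "even (\<Sum>i\<in>UNIV. z $ i - z $ i mod int L)"
    using assms by (intro dvd_sum) (metis dvd_trans even_of_nat dvd_minus_mod)
  then show ?thesis by (simp add: black_def sum_subtractf)
qed

lemma weight_le_large_torus:
  fixes f :: "int ^ 'd \<Rightarrow> int ^ 'd \<Rightarrow> real"
  assumes L: "even L" "4 * M \<le> L" and "0 < M"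
    and f: "weighting L f" "smoothness f < \<delta>" "0 \<le> \<delta>" "real M * \<delta> \<le> 1 / 8"
    and "black x" "y \<in> white_sites L"
  shows "f x y \<le> 1 / real M"
proof -
  obtain i :: 'd where True by blast
  have "0 < L" using L \<open>0 < M\<close> by simp
  have "1 * \<delta> \<le> real M * \<delta>" using f(3) \<open>0 < M\<close> by (intro mult_right_mono) auto
  then have \<delta>1: "\<delta> \<le> 1" using f(4) by simp
  define h where "h j = y + axis i (int (2 * j))" for j
  define g where "g j = (\<chi> l. h j $ l mod int L)" for j
  have g_white: "g j \<in> white_sites L" for j
  proof -
    have "\<not> black (g j)"
      unfolding g_def black_mod[OF L(1)] using \<open>y \<in> white_sites L\<close>
      by (simp add: h_def black_add_axis white_sites_def)
    then show ?thesis using \<open>0 < L\<close> by (simp add: white_sites_def torus_def g_def)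
  qed
  have fg: "f x (g j) = f x (h j)" for j
    unfolding g_def using f(1) by (intro periodic_mod) (auto simp: weighting_def)
  have inj: "inj_on g {..<2 * M}"
  proof (rule inj_onI)
    fix j j' assume j: "j \<in> {..<2 * M}" "j' \<in> {..<2 * M}" and "g j = g j'"
    then have "g j $ i = g j' $ i" by simp
    then have "(y $ i + 2 * int j) mod int L = (y $ i + 2 * int j') mod int L"
      by (simp add: g_def h_def axis_def)
    then have "(2 * int j) mod int L = (2 * int j') mod int L"
      by (simp add: mod_eq_dvd_iff)
    then show "j = j'" using j L(2) by simp
  qed
  have bernoulli: "1 / 2 \<le> (1 - \<delta>) ^ (2 * j)" if "j < 2 * M" for j
  proof -
    have "1 / 2 \<le> 1 + real (4 * M) * (- \<delta>)" using f(4) by simp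
    also have "\<dots> \<le> (1 + - \<delta>) ^ (4 * M)" using \<delta>1 by (intro Bernoulli_inequality) simp
    also have "\<dots> \<le> (1 - \<delta>) ^ (2 * j)" using \<delta>1 f(3) that by (auto intro: power_decreasing)
    finally show ?thesis .
  qed
  have pos: "0 \<le> f x z" for z using f(1) by (simp add: weighting_def less_imp_le)
  have "real M * f x y = (\<Sum>j<2 * M. 1 / 2 * f x y)" by simp
  also have "\<dots> \<le> (\<Sum>j<2 * M. f x (g j))"
  proof (rule sum_mono)
    fix j assume "j \<in> {..<2 * M}"
    then have "1 / 2 * f x y \<le> (1 - \<delta>) ^ (2 * j) * f x y"
      using pos by (intro mult_right_mono bernoulli) auto
    also have "\<dots> \<le> f x (g j)"
      unfolding fg h_def using f \<open>0 < L\<close> \<delta>1 by (intro smooth_line) auto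
    finally show "1 / 2 * f x y \<le> f x (g j)" .
  qed
  also have "\<dots> = (\<Sum>z\<in>g ` {..<2 * M}. f x z)" by (simp add: sum.reindex[OF inj])
  also have "\<dots> \<le> (\<Sum>z\<in>white_sites L. f x z)"
    using g_white pos by (intro sum_mono2 finite_sites) auto
  also have "\<dots> = 1" by (rule weighting_sum_sites(1)[OF f(1) \<open>black x\<close>])
  finally show ?thesis using \<open>0 < M\<close> by (simp add: field_simps)
qed

lemma ln_fact_ge: "real n * ln (real n) - real n \<le> ln (fact n)"
proof (induction n)
  case (Suc n)
  show ?case
  proof (cases "n = 0")
    case False
    have "ln (1 + 1 / real n) \<le> 1 / real n" by (rule ln_add_one_self_le_self) simp
    then have "real n * ln (1 + 1 / real n) \<le> 1" using False by (simp add: field_simps)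
    moreover have "ln (1 + 1 / real n) = ln (real (Suc n)) - ln (real n)"
      using False ln_div[of "real (Suc n)" "real n"] by (simp add: add_divide_distrib add.commute)
    ultimately have "real n * (ln (real (Suc n)) - ln (real n)) \<le> 1" by simp
    then show ?thesis using Suc by (simp add: ln_mult algebra_simps del: of_nat_Suc) (simp add: algebra_simps)
  qed simp
qed simp

lemma sum_ln_shifted_le: "(\<Sum>r<M. ln (real (r + 2))) \<le> real (M + 2) * ln (real (M + 2)) - real M"
proof (induction M)
  case (Suc M)
  have "ln (real (M + 2) / real (M + 3)) \<le> real (M + 2) / real (M + 3) - 1"
    by (intro ln_le_minus_one) simp
  then have "1 \<le> real (M + 3) * (ln (real (M + 3)) - ln (real (M + 2)))"
    by (simp add: ln_div field_simps)
  then show ?case using Suc by (simp add: algebra_simps)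
qed simp

lemma ex_time_resolution:
  assumes "0 < \<epsilon>"
  obtains M where "0 < M" "(\<Sum>r<M. ln (real (r + 2) / real M)) / real M < - 1 + \<epsilon>"
proof -
  have "(\<lambda>M::nat. (real (M + 2) * ln (real (M + 2)) - real M) / real M - ln (real M)) \<longlonglongrightarrow> - 1"
    by real_asymp
  then have "\<forall>\<^sub>F M::nat in sequentially. (real (M + 2) * ln (real (M + 2)) - real M) / real M - ln (real M) < - 1 + \<epsilon>"
    using assms by (intro order_tendstoD) auto
  moreover have "\<forall>\<^sub>F M::nat in sequentially. 0 < M" by (rule eventually_gt_at_top)
  ultimately have "\<forall>\<^sub>F M::nat in sequentially. 0 < M \<and>
      (real (M + 2) * ln (real (M + 2)) - real M) / real M - ln (real M) < - 1 + \<epsilon>"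
    by eventually_elim simp
  then obtain M :: nat where M: "0 < M"
      "(real (M + 2) * ln (real (M + 2)) - real M) / real M - ln (real M) < - 1 + \<epsilon>"
    using eventually_happens'[OF sequentially_bot] by blast
  have "(\<Sum>r<M. ln (real (r + 2) / real M)) = (\<Sum>r<M. ln (real (r + 2)) - ln (real M))"
    using M(1) by (intro sum.cong refl) (simp add: ln_div del: of_nat_add)
  also have "\<dots> = (\<Sum>r<M. ln (real (r + 2))) - real M * ln (real M)"
    by (simp add: sum_subtractf)
  finally have "(\<Sum>r<M. ln (real (r + 2) / real M)) / real M = (\<Sum>r<M. ln (real (r + 2))) / real M - ln (real M)"
    using M(1) by (simp add: diff_divide_distrib)
  also have "\<dots> \<le> (real (M + 2) * ln (real (M + 2)) - real M) / real M - ln (real M)"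
    by (intro diff_right_mono divide_right_mono sum_ln_shifted_le) simp
  finally show ?thesis using M that by fastforce
qed

lemma pressure_diff_lt_large_torus:
  fixes f :: "int ^ 'd \<Rightarrow> int ^ 'd \<Rightarrow> real"
  assumes L: "even L" "0 < N" "2 * N = L ^ CARD('d)" "4 * M \<le> L" and M: "0 < M"
    and f: "weighting L f" "smoothness f < \<delta>" "0 \<le> \<delta>" "real M * \<delta> \<le> 1 / 8"
    and C: "(\<Sum>r<M. ln (real (r + 2) / real M)) / real M < - 1 + \<epsilon>"
  shows "pressure L f - pressure L (constant_weighting N :: int ^ 'd \<Rightarrow> int ^ 'd \<Rightarrow> real) < \<epsilon> / 2"
proof -
  let ?C = "(\<Sum>r<M. ln (real (r + 2) / real M)) / real M"
  note card = card_sites[where 'd = 'd, OF L(1,3)]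
  have "ln (partition_function L f) \<le> real (card (black_sites L :: (int ^ 'd) set)) * ?C"
    unfolding partition_function_eq_permanent[OF L(1-3)]
  proof (rule ln_permanent_le[OF finite_sites _ M])
    fix x y :: "int ^ 'd" assume x: "x \<in> black_sites L" and y: "y \<in> white_sites L"
    show "0 < f x y" using f(1) by (simp add: weighting_def)
    show "f x y \<le> 1 / real M"
      using x by (intro weight_le_large_torus[OF L(1,4) M f _ y]) (simp add: black_sites_def)
  next
    fix x :: "int ^ 'd" assume "x \<in> black_sites L"
    then show "(\<Sum>y\<in>white_sites L. f x y) = 1"
      by (intro weighting_sum_sites(1)[OF f(1)]) (simp add: black_sites_def)
  qed (simp add: card)
  then have "ln (partition_function L f) \<le> real N * ?C" by (simp add: card)
  moreover have "- real N \<le> ln (fact N) - real N * ln (real N)" using ln_fact_ge[of N] by simp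
  moreover have "real N * ?C < real N * (- 1 + \<epsilon>)" using C L(2) by (intro mult_strict_left_mono) auto
  ultimately have "ln (partition_function L f) - (ln (fact N) - real N * ln (real N)) < real N * \<epsilon>"
    by (simp add: algebra_simps)
  then have "(ln (partition_function L f) - (ln (fact N) - real N * ln (real N))) / (2 * real N) < \<epsilon> / 2"
    using L(2) by (simp add: field_simps)
  moreover have "real (L ^ CARD('d)) = 2 * real N" using L(3) by (metis of_nat_mult of_nat_numeral)
  ultimately show ?thesis
    unfolding pressure_constant_weighting[OF L(1-3)] unfolding pressure_def by (simp add: diff_divide_distrib)
qed

lemma pressure_diff_le_near_uniform:
  fixes f :: "int ^ 'd \<Rightarrow> int ^ 'd \<Rightarrow> real"
  assumes L: "even L" "0 < L" "0 < N" "2 * N = L ^ CARD('d)"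
    and f: "weighting L f" "smoothness f < \<delta>" "0 \<le> \<delta>" "\<delta> < 1"
  shows "pressure L f - pressure L (constant_weighting N :: int ^ 'd \<Rightarrow> int ^ 'd \<Rightarrow> real)
    \<le> - ln ((1 - \<delta>) ^ (L * CARD('d))) / 2"
proof -
  let ?B = "black_sites L :: (int ^ 'd) set" and ?W = "white_sites L :: (int ^ 'd) set"
  note card = card_sites[where 'd = 'd, OF L(1,4)]
  define q where "q = (1 - \<delta>) ^ (L * CARD('d))"
  have q: "0 < q" using f by (simp add: q_def)
  have pos: "0 < f x y" for x y using f(1) by (simp add: weighting_def)
  have "permanent ?B ?W f \<le> permanent ?B ?W (\<lambda>_ _. 1 / (real N * q))"
    using pos weight_le_near_uniform[OF L(1,2,4) f] unfolding q_def
    by (intro permanent_mono) (auto simp: black_sites_def less_imp_le)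
  also have "\<dots> = fact N * (1 / (real N * q)) ^ N"
    by (subst permanent_const) (simp_all add: card finite_sites)
  finally have "ln (partition_function L f) \<le> ln (fact N * (1 / (real N * q)) ^ N)"
    unfolding partition_function_eq_permanent[OF L(1,3,4)]
    using permanent_pos[OF finite_sites, of L L f] pos card by (intro ln_mono) auto
  also have "\<dots> = ln (fact N) - real N * ln (real N) - real N * ln q"
    using L(3) q by (simp add: ln_mult ln_realpow ln_div algebra_simps)
  finally have "(ln (partition_function L f) - (ln (fact N) - real N * ln (real N))) / (2 * real N) \<le> - ln q / 2"
    using L(3) by (simp add: field_simps)
  moreover have "real (L ^ CARD('d)) = 2 * real N" using L(4) by (metis of_nat_mult of_nat_numeral)
  ultimately show ?thesis
    unfolding pressure_constant_weighting[OF L(1,3,4)] q_def[symmetric] unfolding pressure_def by (simp add: diff_divide_distrib)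
qed

lemma pressure_close:
  assumes "0 < \<epsilon>"
  shows "\<exists>\<delta>>0. \<forall>L N :: nat. even L \<and> 2 \<le> L \<and> 2 * N = L ^ CARD('d) \<longrightarrow>
    (\<forall>f :: int ^ 'd \<Rightarrow> int ^ 'd \<Rightarrow> real. weighting L f \<and> smoothness f < \<delta> \<longrightarrow>
      \<bar>pressure L f - pressure L (constant_weighting N :: int ^ 'd \<Rightarrow> int ^ 'd \<Rightarrow> real)\<bar> < \<epsilon>)"
proof -
  obtain M where M: "0 < M" "(\<Sum>r<M. ln (real (r + 2) / real M)) / real M < - 1 + \<epsilon>"
    using ex_time_resolution[OF assms] by blast
  define K where "K = 4 * M * CARD('d)"
  have K: "0 < K" using M(1) by (simp add: K_def)
  define \<delta> where "\<delta> = min (1 / (8 * real M)) ((1 - exp (- \<epsilon>)) / real K)"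
  have \<delta>: "0 < \<delta>" using assms M(1) K by (simp add: \<delta>_def)
  have \<delta>M: "real M * \<delta> \<le> 1 / 8"
  proof -
    have "\<delta> \<le> 1 / (8 * real M)" by (simp add: \<delta>_def)
    then show ?thesis using M(1) by (simp add: field_simps)
  qed
  have \<delta>K: "real K * \<delta> \<le> 1 - exp (- \<epsilon>)"
  proof -
    have "\<delta> \<le> (1 - exp (- \<epsilon>)) / real K" by (simp add: \<delta>_def)
    then show ?thesis using K by (simp add: field_simps)
  qed
  have "1 * \<delta> \<le> real M * \<delta>" using \<delta> M(1) by (intro mult_right_mono) auto
  then have \<delta>1: "\<delta> < 1" using \<delta>M by simp
  have "\<bar>pressure L f - pressure L (constant_weighting N :: int ^ 'd \<Rightarrow> int ^ 'd \<Rightarrow> real)\<bar> < \<epsilon>"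
    if L: "even L" "2 \<le> L" "2 * N = L ^ CARD('d)" and f: "weighting L f" "smoothness f < \<delta>"
    for L N and f :: "int ^ 'd \<Rightarrow> int ^ 'd \<Rightarrow> real"
  proof -
    have N: "0 < N" using L by (cases N) auto
    have "pressure L f - pressure L (constant_weighting N :: int ^ 'd \<Rightarrow> int ^ 'd \<Rightarrow> real) < \<epsilon>"
    proof (cases "4 * M \<le> L")
      case True
      from pressure_diff_lt_large_torus[OF L(1) N L(3) True M(1) f less_imp_le[OF \<delta>] \<delta>M M(2)]
      show ?thesis using assms by simp
    next
      case False
      have "exp (- \<epsilon>) \<le> 1 + real K * (- \<delta>)" using \<delta>K by simp
      also have "\<dots> \<le> (1 + - \<delta>) ^ K" using \<delta>1 by (intro Bernoulli_inequality) simp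
      also have "\<dots> \<le> (1 - \<delta>) ^ (L * CARD('d))"
        using False \<delta> \<delta>1 by (auto simp: K_def intro: power_decreasing)
      finally have "- \<epsilon> \<le> ln ((1 - \<delta>) ^ (L * CARD('d)))"
        using \<delta>1 by (subst ln_ge_iff) auto
      moreover have "pressure L f - pressure L (constant_weighting N :: int ^ 'd \<Rightarrow> int ^ 'd \<Rightarrow> real)
          \<le> - ln ((1 - \<delta>) ^ (L * CARD('d))) / 2"
        using L \<delta> \<delta>1 f N by (intro pressure_diff_le_near_uniform) auto
      ultimately show ?thesis using assms by linarith
    qed
    with pressure_ge_constant[OF L(1) N L(3) f(1)] show ?thesis by simp
  qed
  then show ?thesis using \<delta> by blast
qed

theorem mainTheorem1:
  "(\<forall>L N :: nat. even L \<and> 2 \<le> L \<and> 2 * N = L ^ CARD('d) \<longrightarrow>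
      pressure L (constant_weighting N :: int ^ 'd \<Rightarrow> int ^ 'd \<Rightarrow> real)
        = (1 / (2 * real N)) * (ln (fact N) - real N * ln (real N))) \<and>
   (\<forall>\<epsilon>::real. 0 < \<epsilon> \<longrightarrow> (\<exists>\<delta>::real. 0 < \<delta> \<and>
      (\<forall>L N :: nat. even L \<and> 2 \<le> L \<and> 2 * N = L ^ CARD('d) \<longrightarrow>
        (\<forall>f :: int ^ 'd \<Rightarrow> int ^ 'd \<Rightarrow> real. weighting L f \<and> smoothness f < \<delta> \<longrightarrow>
          \<bar>pressure L f - pressure L (constant_weighting N :: int ^ 'd \<Rightarrow> int ^ 'd \<Rightarrow> real)\<bar> < \<epsilon>))))"
proof (intro conjI allI impI)
  fix L N :: nat assume L: "even L \<and> 2 \<le> L \<and> 2 * N = L ^ CARD('d)"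
  then have "0 < N" by (cases N) auto
  with L show "pressure L (constant_weighting N :: int ^ 'd \<Rightarrow> int ^ 'd \<Rightarrow> real)
      = (1 / (2 * real N)) * (ln (fact N) - real N * ln (real N))"
    by (intro pressure_constant_weighting) auto
qed (rule pressure_close)

end
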